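(* Let $\mathbb{B}$ be the algebra of split-quaternions, let $H_6$ be the $6\times 6$ complex Hadamard matrix and $G=\mathrm{Aut}^{\ast}(H_6)\cong 3.\mathcal{S}_6$ the group defined in the context, and let $\rho_1,\rho_2: G\to \mathrm{GL}_6(\mathbb{B})$ be the two maps defined in the context. Then: (1) There exists an irreducible $6$-dimensional monomial representation of $3.\mathcal{S}_6$ over $\mathbb{B}$. (2) The maps $\rho_1$ and $\rho_2$ are $6$-dimensional monomial representations of $G\cong 3.\mathcal{S}_6$ over $\mathbb{B}$ which are conjugate, intertwined by $H_6$: for all $g\in G$, $\rho_1(g)=H_6\,\rho_2(g)\,H_6^{-1}$. They give a construction of the outer automorphism of $\mathcal{S}_6$: writing $\pi$ for the map sending a monomial matrix to its underlying permutation, the rule $\pi(\rho_1(g))\mapsto \pi(\rho_2(g))$, for $g\in G$, is a well-defined automorphism of $\mathcal{S}_6$ that is not inner.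
   Context: $\mathcal{S}_6$ is the symmetric group on $\{1,\dots,6\}$, acting on the right (products of permutations are read left to right). Monomial matrices. A monomial matrix over a ring with $1$ is a square matrix with exactly one nonzero entry in each row and column, that entry being a unit. It factors uniquely as $DK$ with $D$ diagonal and $K$ a permutation matrix. A permutation $\sigma$ corresponds to the permutation matrix $K_\sigma$ with $(K_\sigma)_{j,j^\sigma}=1$ and all other entries $0$, and we set $\pi(DK_\sigma)=\sigma$. The notation $[d_1,\dots,d_6]\,\sigma$ stands for $\mathrm{diag}(d_1,\dots,d_6)K_\sigma$. The matrix. Let $\omega$ be a primitive complex third root of unity, $\overline{\omega}$ its complex conjugate, and $$H_{6} = \begin{pmatrix} 1 & 1 & 1 & 1 & 1 & 1\\ 1 & 1 & \omega & \overline{\omega} & \overline{\omega} & \omega \\ 1 & \omega & 1 & \omega & \overline{\omega} & \overline{\omega} \\ 1 & \overline{\omega} & \omega & 1 & \omega & \overline{\omega} \\ 1 & \overline{\omega} & \overline{\omega} & \omega & 1 & \omega \\ 1 & \omega & \overline{\omega} & \overline{\omega} & \omega & 1 \end{pmatrix},$$ which satisfies $H_6H_6^\dagger=6I_6$, where $\dagger$ denotes conjugate transpose. The group. Let $\ast$ be entrywise complex conjugation, acting on $\mathrm{GL}_6(\mathbb{C})\times \mathrm{GL}_6(\mathbb{C})$ (componentwise) and on $6\times 6$ complex matrices. In the semidirect product $(\mathrm{GL}_6(\mathbb{C})\times \mathrm{GL}_6(\mathbb{C}))\rtimes\langle \ast\rangle$, with $\ast$ of order $2$ and $\ast^{-1}(P,Q)\ast=(\overline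 P,\overline Q)$, let $X=\langle\tau_1,\tau_2,\ast\rangle$ where $$\tau_1=\big([1,1,1,1,1,1](2,3,4,5,6),\ [1,1,1,1,1,1](2,3,4,5,6)\big),$$ $$\tau_2=\big([1,1,\omega,\overline{\omega},\overline{\omega},\omega](1,2),\ [1,1,\overline{\omega},\omega,\omega,\overline{\omega}](1,2)(3,6)(4,5)\big).$$ $X$ acts on the right on $6\times 6$ complex matrices: a pair $(P,Q)$ acts by $M\mapsto P^{-1}MQ$, and $\ast$ acts by entrywise complex conjugation. $G=\mathrm{Aut}^{\ast}(H_6)$ is the stabiliser of $H_6$ in $X$. The group $G$ is isomorphic to $3.\mathcal{S}_6$, the nonsplit extension of $\mathcal{S}_6$ by a normal subgroup of order $3$. Split-quaternions. $\mathbb{B}$ is the $4$-dimensional real algebra with basis $1,i,\beta,\beta i$, where $1,i$ span the usual complex numbers $\mathbb{C}$ (so $i^2=-1$), $\beta^2=1$ and $\beta^{-1} i\beta=-i$. Thus $\mathbb{C}\subset\mathbb{B}$ and complex matrices are regarded as matrices over $\mathbb{B}$; $\beta^{-1}z\beta=\overline z$ for $z\in\mathbb{C}$. $\mathrm{GL}_6(\mathbb{B})$ is the group of invertible $6\times 6$ matrices over $\mathbb{B}$. The representations. Every element of $X$ is uniquely of the form $(P,Q)\ast^{\varepsilon}$ with $\varepsilon\in\{0,1\}$ and $P,Q$ complex monomial matrices. The element $\ast$ is realised $\mathbb{B}$-linearly by the pair $(\beta I_6,\beta I_6)$, and accordingly $$\rho_1((P,Q)\ast^{\varepsilon})=P(\beta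 I_6)^{\varepsilon},\qquad \rho_2((P,Q)\ast^{\varepsilon})=Q(\beta I_6)^{\varepsilon}.$$ A $6$-dimensional representation of a group over $\mathbb{B}$ is a homomorphism to $\mathrm{GL}_6(\mathbb{B})$. It is monomial if its image consists of monomial matrices, and irreducible if the right $\mathbb{B}$-module $\mathbb{B}^6$ of column vectors, with matrices acting by left multiplication, has no invariant $\mathbb{B}$-submodule other than $0$ and $\mathbb{B}^6$. *)

theory Defs
  imports
    "HOL-Analysis.Analysis"
    "HOL-Algebra.Coset"
    "HOL-Algebra.Generated_Groups"
    "HOL-Combinatorics.Cycles"
begin

section \<open>Split-quaternions\<close>

text \<open>
  \<open>SQ a b\<close> stands for \<open>a + \<beta> b\<close> with \<open>a, b\<close> complex.  The product formula is obtained from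
  \<open>z \<beta> = \<beta> (cnj z)\<close> and \<open>\<beta>\<^sup>2 = 1\<close>:
  \<open>(a + \<beta> b) (c + \<beta> d) = (a c + cnj b d) + \<beta> (cnj a d + b c)\<close>.
\<close>

datatype split_quat = SQ (sq_fst: complex) (sq_snd: complex)

instantiation split_quat :: real_algebra_1
begin

definition "0 = SQ 0 0"
definition "1 = SQ 1 0"
definition "x + y = SQ (sq_fst x + sq_fst y) (sq_snd x + sq_snd y)"
definition "- x = SQ (- sq_fst x) (- sq_snd x)"
definition "x - y = SQ (sq_fst x - sq_fst y) (sq_snd x - sq_snd y)"
definition "x * y = SQ (sq_fst x * sq_fst y + cnj (sq_snd x) * sq_snd y)
                       (cnj (sq_fst x) * sq_snd y + sq_snd x * sq_fst y)"
definition "scaleR r x = SQ (r *\<^sub>R sq_fst x) (r *\<^sub>R sq_snd x)"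

instance
  by standard
    (simp_all add: zero_split_quat_def one_split_quat_def plus_split_quat_def
      uminus_split_quat_def minus_split_quat_def times_split_quat_def scaleR_split_quat_def
      split_quat.expand algebra_simps)

end

definition sq_of_complex :: "complex \<Rightarrow> split_quat" where
  "sq_of_complex z = SQ z 0"

definition sq_beta :: split_quat where
  "sq_beta = SQ 0 1"

lemmas split_quat_defs =
  zero_split_quat_def one_split_quat_def plus_split_quat_def uminus_split_quat_def
  minus_split_quat_def times_split_quat_def scaleR_split_quat_def
  sq_of_complex_def sq_beta_def

lemma sq_of_complex_hom:
  "sq_of_complex 1 = 1"
  "sq_of_complex (x + y) = sq_of_complex x + sq_of_complex y"
  "sq_of_complex (x * y) = sq_of_complex x * sq_of_complex y"
  "sq_of_complex (r *\<^sub>R x) = r *\<^sub>R sq_of_complex x"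
  "inj sq_of_complex"
  by (auto simp: split_quat_defs inj_def)

lemma sq_beta_square: "sq_beta * sq_beta = 1"
  by (simp add: split_quat_defs)

lemma sq_beta_conj: "sq_beta * sq_of_complex z * sq_beta = sq_of_complex (cnj z)"
  by (simp add: split_quat_defs)

lemma split_quat_basis:
  "\<exists>!(a, b, c, d). x = a *\<^sub>R 1 + b *\<^sub>R sq_of_complex \<i> + c *\<^sub>R sq_beta
                        + d *\<^sub>R (sq_beta * sq_of_complex \<i>)"
proof -
  have "x = a *\<^sub>R 1 + b *\<^sub>R sq_of_complex \<i> + c *\<^sub>R sq_beta
              + d *\<^sub>R (sq_beta * sq_of_complex \<i>) \<longleftrightarrow>
        a = Re (sq_fst x) \<and> b = Im (sq_fst x) \<and> c = Re (sq_snd x) \<and> d = Im (sq_snd x)"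
    for a b c d
    by (cases x) (auto simp: split_quat_defs complex_eq_iff)
  then show ?thesis
    by auto
qed


section \<open>Monomial matrices\<close>

definition ring_unit :: "'a::ring_1 \<Rightarrow> bool" where
  "ring_unit x \<longleftrightarrow> (\<exists>y. x * y = 1 \<and> y * x = 1)"

definition monomial_matrix :: "'a::ring_1^'n^'n \<Rightarrow> bool" where
  "monomial_matrix A \<longleftrightarrow>
     (\<forall>i. \<exists>!j. A $ i $ j \<noteq> 0) \<and> (\<forall>j. \<exists>!i. A $ i $ j \<noteq> 0) \<and>
     (\<forall>i j. A $ i $ j \<noteq> 0 \<longrightarrow> ring_unit (A $ i $ j))"

definition diag_matrix :: "'a::zero^'n \<Rightarrow> 'a^'n^'n" where
  "diag_matrix d = (\<chi> i j. if i = j then d $ i else 0)"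

definition perm_matrix :: "('n \<Rightarrow> 'n) \<Rightarrow> 'a::zero_neq_one^'n^'n" where
  "perm_matrix \<sigma> = (\<chi> i j. if j = \<sigma> i then 1 else 0)"

definition underlying_perm :: "'a::ring_1^'n^'n \<Rightarrow> ('n \<Rightarrow> 'n)" where
  "underlying_perm A = (THE \<sigma>. bij \<sigma> \<and> (\<exists>d. A = diag_matrix d ** perm_matrix \<sigma>))"

text \<open>Permutations act on the right, so the product of \<open>\<sigma>\<close> and \<open>\<tau>\<close> is ``first \<open>\<sigma>\<close>, then \<open>\<tau>\<close>''.\<close>

definition symmetric_group :: "('n \<Rightarrow> 'n) monoid" where
  "symmetric_group = \<lparr>carrier = {\<sigma>. bij \<sigma>}, mult = (\<lambda>\<sigma> \<tau>. \<tau> \<circ> \<sigma>), one = id\<rparr>"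


section \<open>Groups and representations\<close>

definition GL :: "('a::semiring_1^'n^'n) monoid" where
  "GL = \<lparr>carrier = {A. invertible A}, mult = (**), one = mat 1\<rparr>"

definition inner_automorphism :: "('g, 'm) monoid_scheme \<Rightarrow> ('g \<Rightarrow> 'g) \<Rightarrow> bool" where
  "inner_automorphism S \<phi> \<longleftrightarrow>
     (\<exists>a\<in>carrier S. \<forall>x\<in>carrier S. \<phi> x = inv\<^bsub>S\<^esub> a \<otimes>\<^bsub>S\<^esub> x \<otimes>\<^bsub>S\<^esub> a)"

definition nonsplit_extension ::
    "('g, 'm) monoid_scheme \<Rightarrow> 'g set \<Rightarrow> ('q, 'r) monoid_scheme \<Rightarrow> bool" where
  "nonsplit_extension E N Q \<longleftrightarrow>
     N \<lhd> E \<and> (E Mod N) \<cong> Q \<and>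
     \<not> (\<exists>C. subgroup C E \<and> C \<inter> N = {\<one>\<^bsub>E\<^esub>} \<and> N <#>\<^bsub>E\<^esub> C = carrier E)"

definition matrix_representation ::
    "('g, 'm) monoid_scheme \<Rightarrow> ('g \<Rightarrow> 'a::ring_1^'n^'n) \<Rightarrow> bool" where
  "matrix_representation K \<rho> \<longleftrightarrow> \<rho> \<in> hom K GL"

definition monomial_representation ::
    "('g, 'm) monoid_scheme \<Rightarrow> ('g \<Rightarrow> 'a::ring_1^'n^'n) \<Rightarrow> bool" where
  "monomial_representation K \<rho> \<longleftrightarrow>
     matrix_representation K \<rho> \<and> (\<forall>g\<in>carrier K. monomial_matrix (\<rho> g))"

definition right_submodule :: "('a::ring_1^'n) set \<Rightarrow> bool" where
  "right_submodule W \<longleftrightarrow>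
     0 \<in> W \<and> (\<forall>v\<in>W. \<forall>w\<in>W. v + w \<in> W) \<and> (\<forall>v\<in>W. \<forall>b. (\<chi> i. v $ i * b) \<in> W)"

definition irreducible_representation ::
    "('g, 'm) monoid_scheme \<Rightarrow> ('g \<Rightarrow> 'a::ring_1^'n^'n) \<Rightarrow> bool" where
  "irreducible_representation K \<rho> \<longleftrightarrow>
     matrix_representation K \<rho> \<and>
     (\<forall>W. right_submodule W \<and> (\<forall>g\<in>carrier K. \<forall>v\<in>W. \<rho> g *v v \<in> W) \<longrightarrow> W = {0} \<or> W = UNIV)"


section \<open>The semidirect product with entrywise conjugation and its action\<close>

text \<open>
  The triple \<open>(P, Q, e)\<close> stands for \<open>(P, Q)\<close> if \<open>e\<close> is false and for \<open>(P, Q) *\<close> if \<open>e\<close> is true.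
  As \<open>* (P', Q') = (cnj P', cnj Q') *\<close>, the second pair is conjugated when it is moved past \<open>*\<close>.
\<close>

type_synonym 'n pair_star = "(complex^'n^'n) \<times> (complex^'n^'n) \<times> bool"

definition conj_if :: "bool \<Rightarrow> complex^'n^'n \<Rightarrow> complex^'n^'n" where
  "conj_if e M = (if e then map_matrix cnj M else M)"

definition GL_pair_star :: "'n::finite pair_star monoid" where
  "GL_pair_star =
     \<lparr>carrier = {(P, Q, e). invertible P \<and> invertible Q},
      mult = (\<lambda>(P, Q, e) (P', Q', e'). (P ** conj_if e P', Q ** conj_if e Q', e \<noteq> e')),
      one = (mat 1, mat 1, False)\<rparr>"

fun star_action :: "complex^'n^'n \<Rightarrow> 'n::finite pair_star \<Rightarrow> complex^'n^'n" where
  "star_action M (P, Q, e) = conj_if e (matrix_inv P ** M ** Q)"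


section \<open>The matrix, its group, and the two representations\<close>

text \<open>
  The index type \<open>6\<close> consists of the residues modulo 6; its six elements are 1, 2, 3, 4, 5 and
  6 = 0, and \<open>vector [x1, ..., x6]\<close> has entry \<open>xk\<close> at index \<open>k\<close>.
\<close>

definition primitive_root_of_unity :: "nat \<Rightarrow> complex \<Rightarrow> bool" where
  "primitive_root_of_unity n z \<longleftrightarrow> n > 0 \<and> z ^ n = 1 \<and> (\<forall>k. 0 < k \<and> k < n \<longrightarrow> z ^ k \<noteq> 1)"

definition H6 :: "complex \<Rightarrow> complex^6^6" where
  "H6 \<omega> = vector
    [vector [1, 1,     1,     1,     1,     1    ],
     vector [1, 1,     \<omega>,     cnj \<omega>, cnj \<omega>, \<omega>    ],
     vector [1, \<omega>,     1,     \<omega>,     cnj \<omega>, cnj \<omega>],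
     vector [1, cnj \<omega>, \<omega>,     1,     \<omega>,     cnj \<omega>],
     vector [1, cnj \<omega>, cnj \<omega>, \<omega>,     1,     \<omega>    ],
     vector [1, \<omega>,     cnj \<omega>, cnj \<omega>, \<omega>,     1    ]]"

definition mono6 :: "complex list \<Rightarrow> (6 \<Rightarrow> 6) \<Rightarrow> complex^6^6" where
  "mono6 ds \<sigma> = diag_matrix (vector ds) ** perm_matrix \<sigma>"

definition tau1 :: "6 pair_star" where
  "tau1 = (mono6 [1, 1, 1, 1, 1, 1] (cycle_of_list [2, 3, 4, 5, 6]),
           mono6 [1, 1, 1, 1, 1, 1] (cycle_of_list [2, 3, 4, 5, 6]),
           False)"

definition tau2 :: "complex \<Rightarrow> 6 pair_star" where
  "tau2 \<omega> = (mono6 [1, 1, \<omega>, cnj \<omega>, cnj \<omega>, \<omega>] (cycle_of_list [1, 2]),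
             mono6 [1, 1, cnj \<omega>, \<omega>, \<omega>, cnj \<omega>]
               (cycle_of_list [1, 2] \<circ> cycle_of_list [3, 6] \<circ> cycle_of_list [4, 5]),
             False)"

definition star :: "6 pair_star" where
  "star = (mat 1, mat 1, True)"

definition X_group :: "complex \<Rightarrow> 6 pair_star monoid" where
  "X_group \<omega> = GL_pair_star\<lparr>carrier := generate GL_pair_star {tau1, tau2 \<omega>, star}\<rparr>"

definition Aut_star_H6 :: "complex \<Rightarrow> 6 pair_star monoid" where
  "Aut_star_H6 \<omega> =
     (X_group \<omega>)\<lparr>carrier := {x \<in> carrier (X_group \<omega>). star_action (H6 \<omega>) x = H6 \<omega>}\<rparr>"

abbreviation sq_matrix :: "complex^'n^'n \<Rightarrow> split_quat^'n^'n" where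
  "sq_matrix \<equiv> map_matrix sq_of_complex"

text \<open>\<open>mat sq_beta\<close> is the scalar matrix with \<open>sq_beta\<close> on the diagonal.\<close>

fun rho1 :: "6 pair_star \<Rightarrow> split_quat^6^6" where
  "rho1 (P, Q, e) = sq_matrix P ** (if e then mat sq_beta else mat 1)"

fun rho2 :: "6 pair_star \<Rightarrow> split_quat^6^6" where
  "rho2 (P, Q, e) = sq_matrix Q ** (if e then mat sq_beta else mat 1)"

end

(*
Scaling the rows and monomially permuting the columns maps H6 to itself or to its conjugate only
if both operations are the same scalar: comparing with the first column, which is constant, shows
that entrywise multiplication by the inverse of some column m, possibly combined with conjugation,
permutes the columns, and this happens only for m = 1 without conjugation.  As H6 is symmetric, the
same holds with rows and columns exchanged.
Hence both projections of G to S6 have the cube root scalars as kernel; the first is onto because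
the images of tau1 and of tau2 * generate S6.  This gives an automorphism of S6, which sends the
transposition (1,2) to the fixed point free permutation (1,2)(3,6)(4,5), so it is not inner.

The extension does not split because two disjoint 3-cycles have lifts whose commutator is the
scalar omega; lifts differ by central scalars, so every pair of lifts has this commutator.

An invariant submodule that contains a vector v contains the vector with first coordinate v_1 and
the others 0, since that projection is a real combination of group elements.  As the scalar omega
acts from the left and all split-quaternions from the right, it then contains a basis vector.
*)
theory Submission
  imports Defs
begin

section \<open>The six-element index type\<close>

lemma exhaust_6: "x = 1 \<or> x = 2 \<or> x = 3 \<or> x = 4 \<or> x = 5 \<or> x = 6" for x :: 6
proof (induct x)
  case (of_int z)
  then have "0 \<le> z" "z < 6" by simp_all
  then have "z = 0 \<or> z = 1 \<or> z = 2 \<or> z = 3 \<or> z = 4 \<or> z = 5" by arith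
  then show ?case by auto
qed

lemma forall_6: "(\<forall>i::6. P i) \<longleftrightarrow> P 1 \<and> P 2 \<and> P 3 \<and> P 4 \<and> P 5 \<and> P 6"
  by (metis exhaust_6)

lemma ex_6: "(\<exists>i::6. P i) \<longleftrightarrow> P 1 \<or> P 2 \<or> P 3 \<or> P 4 \<or> P 5 \<or> P 6"
  using forall_6[of "\<lambda>i. \<not> P i"] by blast

lemma UNIV_6: "(UNIV::6 set) = {1, 2, 3, 4, 5, 6}"
  using exhaust_6 by auto

lemma sum_6: "sum f (UNIV::6 set) = f 1 + f 2 + f 3 + f 4 + f 5 + f 6"
  unfolding UNIV_6 by (simp add: ac_simps)

lemma vector_6 [simp]:
  "(vector [a, b, c, d, e, f] :: 'a::zero^6) $ 1 = a"
  "(vector [a, b, c, d, e, f] :: 'a::zero^6) $ 2 = b"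
  "(vector [a, b, c, d, e, f] :: 'a::zero^6) $ 3 = c"
  "(vector [a, b, c, d, e, f] :: 'a::zero^6) $ 4 = d"
  "(vector [a, b, c, d, e, f] :: 'a::zero^6) $ 5 = e"
  "(vector [a, b, c, d, e, f] :: 'a::zero^6) $ 6 = f"
  by (simp_all add: vector_def)

section \<open>Monomial matrices\<close>

abbreviation monom_mat :: "'a::ring_1^'n \<Rightarrow> ('n \<Rightarrow> 'n) \<Rightarrow> 'a^'n^'n" where
  "monom_mat d \<sigma> \<equiv> diag_matrix d ** perm_matrix \<sigma>"

lemma monom_mat_nth: "monom_mat d \<sigma> $ i $ j = (if j = \<sigma> i then d $ i else 0)"
  by (simp add: matrix_matrix_mult_def diag_matrix_def perm_matrix_def mult_delta_left)

lemma monom_mat_eq: "monom_mat d \<sigma> = (\<chi> i j. if j = \<sigma> i then d $ i else 0)"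
  by (simp add: vec_eq_iff monom_mat_nth)

lemma monom_mat_matrix_mult: "(monom_mat d \<sigma> ** A) $ i $ j = d $ i * A $ \<sigma> i $ j"
  by (simp add: matrix_matrix_mult_def[of "monom_mat d \<sigma>"] monom_mat_nth mult_delta_left)

text \<open>Indexing the column by \<open>\<tau> k\<close> keeps inverse permutations out of the
  formula.\<close>

lemma matrix_mult_monom_mat:
  assumes "bij \<tau>"
  shows "(A ** monom_mat d \<tau>) $ i $ \<tau> k = A $ i $ k * d $ k"
  using bij_is_inj[OF assms]
  by (simp add: matrix_matrix_mult_def[of A] monom_mat_nth mult_delta_right inj_eq)

lemma monom_mat_mult:
  "monom_mat d \<sigma> ** monom_mat d' \<tau> = monom_mat (\<chi> i. d $ i * d' $ \<sigma> i) (\<tau> \<circ> \<sigma>)"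
  by (simp add: vec_eq_iff monom_mat_matrix_mult) (simp add: monom_mat_nth)

lemma monom_mat_vector_mult: "monom_mat d \<sigma> *v v = (\<chi> i. d $ i * v $ \<sigma> i)"
  by (simp add: matrix_vector_mult_def monom_mat_nth mult_delta_left)

lemma monom_mat_id: "monom_mat (\<chi> i. c) id = mat c"
  by (auto simp: vec_eq_iff monom_mat_nth mat_def)

lemma map_matrix_monom_mat:
  "f 0 = 0 \<Longrightarrow> map_matrix f (monom_mat d \<sigma>) = monom_mat (\<chi> i. f (d $ i)) \<sigma>"
  by (simp add: vec_eq_iff monom_mat_nth)

text \<open>The entries may come from a noncommutative ring such as the split-quaternions, so
  \<open>u\<close> is assumed to invert \<open>d\<close> from both sides.\<close>

lemma monom_mat_inverse:
  assumes "bij \<sigma>" "\<And>i. d $ i * u i = 1" "\<And>i. u i * d $ i = 1"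
  shows "monom_mat d \<sigma> ** monom_mat (\<chi> i. u (inv_into UNIV \<sigma> i)) (inv_into UNIV \<sigma>) = mat 1"
    and "monom_mat (\<chi> i. u (inv_into UNIV \<sigma> i)) (inv_into UNIV \<sigma>) ** monom_mat d \<sigma> = mat 1"
  using assms bij_is_inj[OF assms(1)] bij_is_surj[OF assms(1)]
  by (simp_all add: monom_mat_mult flip: monom_mat_id) (simp add: surj_iff)

lemma ring_unit_nonzero: "ring_unit x \<Longrightarrow> x \<noteq> 0"
  by (auto simp: ring_unit_def)

lemma ring_unit_mult: "ring_unit x \<Longrightarrow> ring_unit y \<Longrightarrow> ring_unit (x * y)"
  unfolding ring_unit_def by (metis mult.assoc mult.right_neutral)

lemma invertible_monom_mat:
  assumes "bij \<sigma>" "\<And>i. ring_unit (d $ i)"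
  shows "invertible (monom_mat d \<sigma>)"
proof -
  obtain u where "\<And>i. d $ i * u i = 1 \<and> u i * d $ i = 1"
    using assms(2) unfolding ring_unit_def by metis
  then show ?thesis
    using monom_mat_inverse[OF assms(1), of d u] unfolding invertible_def by blast
qed

lemma monomial_matrix_monom_mat:
  assumes "bij \<sigma>" "\<And>i. ring_unit (d $ i)"
  shows "monomial_matrix (monom_mat d \<sigma>)"
  using assms ring_unit_nonzero[OF assms(2)] bij_pointE[OF assms(1)]
  unfolding monomial_matrix_def monom_mat_nth by (auto split: if_splits) metis+

lemma underlying_perm_monom_mat:
  assumes "bij \<sigma>" "\<And>i. d $ i \<noteq> 0"
  shows "underlying_perm (monom_mat d \<sigma>) = \<sigma>"
  unfolding underlying_perm_def
proof (rule the_equality)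
  fix \<tau> assume "bij \<tau> \<and> (\<exists>d'. monom_mat d \<sigma> = monom_mat d' \<tau>)"
  then obtain d' where "monom_mat d \<sigma> $ i $ j = monom_mat d' \<tau> $ i $ j" for i j by auto
  \<comment> \<open>Row \<open>i\<close> of both matrices is compared in column
    \<open>\<sigma> i\<close>, where the first one has its nonzero entry.\<close>
  then have "d $ i = (if \<sigma> i = \<tau> i then d' $ i else 0)" for i
    by (metis monom_mat_nth)
  with assms(2) show "\<tau> = \<sigma>" by (metis ext)
qed (use assms in auto)

section \<open>Pairs of matrices with conjugation\<close>

lemma conj_if_simps [simp]:
  "conj_if e (mat 1) = mat 1" "conj_if False A = A"
  "conj_if e (conj_if e' A) = conj_if (e \<noteq> e') A"
  by (auto simp: conj_if_def vec_eq_iff mat_def)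

lemma conj_if_mult: "conj_if e (A ** B) = conj_if e A ** conj_if e B"
  by (simp add: conj_if_def vec_eq_iff matrix_matrix_mult_def)

lemma conj_if_eq_iff: "conj_if e A = B \<longleftrightarrow> A = conj_if e B"
  by (metis (full_types) conj_if_simps(2,3))

lemma invertible_conj_if: "invertible A \<Longrightarrow> invertible (conj_if e A)"
  unfolding invertible_def by (metis conj_if_mult conj_if_simps(1))

lemma group_GL_pair_star: "group (GL_pair_star :: 'n::finite pair_star monoid)"
proof (rule groupI)
  fix x :: "'n pair_star" assume "x \<in> carrier GL_pair_star"
  then obtain P Q e where x: "x = (P, Q, e)" "invertible P" "invertible Q"
    by (auto simp: GL_pair_star_def)
  then obtain P' Q' where "P' ** P = mat 1" "P ** P' = mat 1" "Q' ** Q = mat 1" "Q ** Q' = mat 1"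
    unfolding invertible_def by blast
  \<comment> \<open>If \<open>e\<close> holds, the inverse of \<open>(P, Q) *\<close> is
    \<open>*\<close> followed by the inverse pair; moving \<open>*\<close> to the right conjugates
    that pair.\<close>
  then have "(conj_if e P', conj_if e Q', e) \<in> carrier GL_pair_star"
    and "(conj_if e P', conj_if e Q', e) \<otimes>\<^bsub>GL_pair_star\<^esub> x = \<one>\<^bsub>GL_pair_star\<^esub>"
    unfolding x GL_pair_star_def
    by (auto simp flip: conj_if_mult intro!: invertible_conj_if) (auto simp: invertible_def)
  then show "\<exists>y\<in>carrier GL_pair_star. y \<otimes>\<^bsub>GL_pair_star\<^esub> x = \<one>\<^bsub>GL_pair_star\<^esub>" by blast
qed (auto simp: GL_pair_star_def conj_if_mult matrix_mul_assoc
      intro!: invertible_mult invertible_conj_if, simp add: invertible_def)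

lemma matrix_inv_cancel:
  assumes "invertible A"
  shows "A ** matrix_inv A = mat 1" "matrix_inv A ** A = mat 1"
  using someI_ex[OF assms[unfolded invertible_def]] unfolding matrix_inv_def by auto

text \<open>Conjugation is an involution and can be moved to the other side; multiplying by
  \<open>P\<close> then gives a stabiliser condition free of inverses.\<close>

lemma star_action_fixed_iff:
  assumes "invertible P"
  shows "star_action M (P, Q, e) = M \<longleftrightarrow> M ** Q = P ** conj_if e M"
proof -
  have "star_action M (P, Q, e) = M \<longleftrightarrow> matrix_inv P ** (M ** Q) = conj_if e M"
    by (simp add: conj_if_eq_iff matrix_mul_assoc)
  also have "\<dots> \<longleftrightarrow> M ** Q = P ** conj_if e M"
    by (metis matrix_inv_cancel[OF assms] matrix_mul_assoc matrix_mul_lid)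
  finally show ?thesis .
qed

section \<open>Monomial pairs with cube roots of unity as entries, and stabilisers\<close>

definition cube_monomial :: "'n::finite pair_star \<Rightarrow> bool" where
  "cube_monomial x \<longleftrightarrow> (\<exists>p \<sigma> q \<tau> e. x = (monom_mat p \<sigma>, monom_mat q \<tau>, e) \<and> bij \<sigma> \<and> bij \<tau> \<and>
     (\<forall>i. p $ i ^ 3 = 1) \<and> (\<forall>i. q $ i ^ 3 = 1))"

lemma cube_monomialI:
  "bij \<sigma> \<Longrightarrow> bij \<tau> \<Longrightarrow> (\<And>i. p $ i ^ 3 = 1) \<Longrightarrow> (\<And>i. q $ i ^ 3 = 1) \<Longrightarrow>
   cube_monomial (monom_mat p \<sigma>, monom_mat q \<tau>, e)"
  unfolding cube_monomial_def by blast

lemma cube_root_1_nonzero: "z ^ 3 = 1 \<Longrightarrow> (z::'a::field) \<noteq> 0"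
  by auto

lemma ring_unit_field: "(z::'a::field) \<noteq> 0 \<Longrightarrow> ring_unit z"
  unfolding ring_unit_def by (intro exI[of _ "inverse z"]) simp

lemma conj_if_monom_mat:
  "conj_if e (monom_mat d \<sigma>) = monom_mat (\<chi> i. if e then cnj (d $ i) else d $ i) \<sigma>"
  by (simp add: conj_if_def map_matrix_monom_mat)

lemma carrier_GL_pair_star: "(P, Q, e) \<in> carrier GL_pair_star \<longleftrightarrow> invertible P \<and> invertible Q"
  by (simp add: GL_pair_star_def)

lemma mult_GL_pair_star:
  "(P, Q, e) \<otimes>\<^bsub>GL_pair_star\<^esub> (P', Q', e') = (P ** conj_if e P', Q ** conj_if e Q', e \<noteq> e')"
  by (simp add: GL_pair_star_def)

lemma one_GL_pair_star: "\<one>\<^bsub>GL_pair_star\<^esub> = (mat 1, mat 1, False)"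
  by (simp add: GL_pair_star_def)

text \<open>Since the generators of \<open>X_group\<close> lie in this subgroup, every element of
  the generated group has monomial components whose entries are cube roots of unity. The group
  itself is never enumerated.\<close>

lemma subgroup_cube_monomial:
  "subgroup {x. cube_monomial x} (GL_pair_star :: 'n::finite pair_star monoid)"
proof -
  interpret group "GL_pair_star :: 'n::finite pair_star monoid"
    by (rule group_GL_pair_star)
  have carr: "x \<in> carrier GL_pair_star" if "cube_monomial x" for x :: "'n pair_star"
    using that unfolding cube_monomial_def
    by (auto simp: carrier_GL_pair_star cube_root_1_nonzero
        intro!: invertible_monom_mat ring_unit_field)
  show ?thesis
  proof (rule subgroupI)
    have "cube_monomial (monom_mat (\<chi> i. 1) id, monom_mat (\<chi> i. 1) id, False :: bool)"
      by (rule cube_monomialI) auto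
    then show "{x :: 'n pair_star. cube_monomial x} \<noteq> {}" by blast
  next
    fix x y :: "'n pair_star"
    assume "x \<in> {x. cube_monomial x}" "y \<in> {x. cube_monomial x}"
    then obtain p \<sigma> q \<tau> e p' \<sigma>' q' \<tau>' e' where
      xy: "x = (monom_mat p \<sigma>, monom_mat q \<tau>, e)" "y = (monom_mat p' \<sigma>', monom_mat q' \<tau>', e')"
      and "bij \<sigma>" "bij \<tau>" "\<forall>i. p $ i ^ 3 = 1" "\<forall>i. q $ i ^ 3 = 1"
        "bij \<sigma>'" "bij \<tau>'" "\<forall>i. p' $ i ^ 3 = 1" "\<forall>i. q' $ i ^ 3 = 1"
      unfolding cube_monomial_def by blast
    then show "x \<otimes>\<^bsub>GL_pair_star\<^esub> y \<in> {x. cube_monomial x}"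
      unfolding xy mult_GL_pair_star conj_if_monom_mat monom_mat_mult mem_Collect_eq
      by (intro cube_monomialI bij_comp)
        (simp_all add: power_mult_distrib flip: complex_cnj_power)
  next
    fix x :: "'n pair_star"
    assume "x \<in> {x. cube_monomial x}"
    then obtain p \<sigma> q \<tau> e where x: "x = (monom_mat p \<sigma>, monom_mat q \<tau>, e)"
      and bij: "bij \<sigma>" "bij \<tau>" and cube: "\<And>i. p $ i ^ 3 = 1" "\<And>i. q $ i ^ 3 = 1"
      unfolding cube_monomial_def by blast
    note nz = cube_root_1_nonzero[OF cube(1)] cube_root_1_nonzero[OF cube(2)]
    let ?P = "monom_mat (\<chi> i. inverse (p $ inv_into UNIV \<sigma> i)) (inv_into UNIV \<sigma>)"
    let ?Q = "monom_mat (\<chi> i. inverse (q $ inv_into UNIV \<tau> i)) (inv_into UNIV \<tau>)"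
    let ?y = "(conj_if e ?P, conj_if e ?Q, e)"
    have y: "cube_monomial ?y"
      unfolding conj_if_monom_mat
      by (rule cube_monomialI)
        (auto simp: bij bij_imp_bij_inv power_inverse cube simp flip: complex_cnj_power)
    have "?y \<otimes>\<^bsub>GL_pair_star\<^esub> x = \<one>\<^bsub>GL_pair_star\<^esub>"
      unfolding x mult_GL_pair_star one_GL_pair_star conj_if_mult[symmetric]
      using nz monom_mat_inverse(2)[OF bij(1), of p "\<lambda>i. inverse (p $ i)"]
        monom_mat_inverse(2)[OF bij(2), of q "\<lambda>i. inverse (q $ i)"] by simp
    then have "inv\<^bsub>GL_pair_star\<^esub> x = ?y"
      by (rule inv_equality) (use y \<open>x \<in> _\<close> carr in auto)
    with y show "inv\<^bsub>GL_pair_star\<^esub> x \<in> {x. cube_monomial x}" by simp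
  qed (use carr in auto)
qed

text \<open>The equation \<open>M ** Q = P ** conj_if e M\<close> passes to products and inverses
  because conjugation is multiplicative.\<close>

lemma subgroup_star_action_stabiliser:
  fixes M :: "complex^'n::finite^'n"
  shows "subgroup {x \<in> carrier GL_pair_star. star_action M x = M} GL_pair_star"
proof -
  interpret group "GL_pair_star :: 'n pair_star monoid"
    by (rule group_GL_pair_star)
  let ?S = "{x \<in> carrier GL_pair_star. star_action M x = M}"
  have mem: "(P, Q, e) \<in> ?S \<longleftrightarrow> invertible P \<and> invertible Q \<and> M ** Q = P ** conj_if e M" for P Q e
    using star_action_fixed_iff[of P M Q e] by (auto simp: carrier_GL_pair_star)
  show ?thesis
  proof (rule subgroupI)
    have "(mat 1, mat 1, False) \<in> ?S"
      unfolding mem by (auto simp: invertible_def)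
    then show "?S \<noteq> {}" by blast
  next
    fix x y assume xy: "x \<in> ?S" "y \<in> ?S"
    obtain P Q e P' Q' e' where x: "x = (P, Q, e)" and y: "y = (P', Q', e')"
      by (metis prod_cases3)
    have 1: "M ** Q = P ** conj_if e M" "M ** Q' = P' ** conj_if e' M"
      using xy unfolding x y mem by auto
    have "M ** (Q ** conj_if e Q') = P ** conj_if e (M ** Q')"
      by (simp only: conj_if_mult matrix_mul_assoc 1(1))
    also have "\<dots> = P ** conj_if e P' ** conj_if (e \<noteq> e') M"
      by (simp add: 1 conj_if_mult matrix_mul_assoc)
    finally show "x \<otimes>\<^bsub>GL_pair_star\<^esub> y \<in> ?S"
      using xy unfolding x y mult_GL_pair_star mem
      by (auto intro: invertible_mult invertible_conj_if)
  next
    fix x assume xS: "x \<in> ?S"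
    then have x: "x \<in> carrier GL_pair_star" by simp
    obtain P Q e where xe: "x = (P, Q, e)" by (metis prod_cases3)
    obtain P' Q' e' where ye: "inv\<^bsub>GL_pair_star\<^esub> x = (P', Q', e')" by (metis prod_cases3)
    have inv: "invertible P" "invertible P'" "invertible Q'"
      using x inv_closed[OF x] unfolding ye unfolding xe by (auto simp: carrier_GL_pair_star)
    have "x \<otimes>\<^bsub>GL_pair_star\<^esub> inv\<^bsub>GL_pair_star\<^esub> x = \<one>\<^bsub>GL_pair_star\<^esub>"
      using x by (rule r_inv)
    then have 1: "P ** conj_if e P' = mat 1" "Q ** conj_if e Q' = mat 1" "e' = e"
      unfolding ye unfolding xe by (auto simp: mult_GL_pair_star one_GL_pair_star)
    have "P ** conj_if e (M ** Q') = M ** (Q ** conj_if e Q')"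
      using xS mem[of P Q e] by (simp add: xe conj_if_mult matrix_mul_assoc)
    also have "\<dots> = P ** conj_if e P' ** M"
      by (simp add: 1)
    also have "\<dots> = P ** conj_if e (P' ** conj_if e M)"
      by (simp add: conj_if_mult matrix_mul_assoc)
    finally have "conj_if e (M ** Q') = conj_if e (P' ** conj_if e M)"
      using matrix_inv_cancel[OF inv(1)] by (metis matrix_mul_assoc matrix_mul_lid)
    then have "M ** Q' = P' ** conj_if e' M"
      unfolding 1(3) by (simp add: conj_if_eq_iff)
    then show "inv\<^bsub>GL_pair_star\<^esub> x \<in> ?S"
      using mem inv by (auto simp: ye)
  qed auto
qed

text \<open>The two sides of the inverse-free condition are compared entry by entry in the columns
  \<open>\<tau> k\<close>, which run through all columns.\<close>

lemma star_action_fixed_monom_mat_iff: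
  assumes "bij \<sigma>" "bij \<tau>" "\<And>i. p $ i \<noteq> 0"
  shows "star_action M (monom_mat p \<sigma>, monom_mat q \<tau>, e) = M \<longleftrightarrow>
    (\<forall>i k. M $ i $ k * q $ k = p $ i * conj_if e M $ \<sigma> i $ \<tau> k)"
proof -
  have all: "(\<forall>j. R j) \<longleftrightarrow> (\<forall>k. R (\<tau> k))" for R
    using assms(2) by (metis bij_pointE)
  have "star_action M (monom_mat p \<sigma>, monom_mat q \<tau>, e) = M \<longleftrightarrow>
      M ** monom_mat q \<tau> = monom_mat p \<sigma> ** conj_if e M"
    by (intro star_action_fixed_iff invertible_monom_mat assms ring_unit_field)
  also have "\<dots> \<longleftrightarrow> (\<forall>i j. (M ** monom_mat q \<tau>) $ i $ j = (monom_mat p \<sigma> ** conj_if e M) $ i $ j)"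
    by (simp add: vec_eq_iff)
  also have "\<dots> \<longleftrightarrow> (\<forall>i k. M $ i $ k * q $ k = p $ i * conj_if e M $ \<sigma> i $ \<tau> k)"
    by (subst all) (simp add: matrix_mult_monom_mat[OF assms(2)] monom_mat_matrix_mult)
  finally show ?thesis .
qed

section \<open>Explicit products of monomial pairs\<close>

lemma cycle_5 [simp]:
  "cycle_of_list [2, 3, 4, 5, 6 :: 6] 1 = 1" "cycle_of_list [2, 3, 4, 5, 6 :: 6] 2 = 3"
  "cycle_of_list [2, 3, 4, 5, 6 :: 6] 3 = 4" "cycle_of_list [2, 3, 4, 5, 6 :: 6] 4 = 5"
  "cycle_of_list [2, 3, 4, 5, 6 :: 6] 5 = 6" "cycle_of_list [2, 3, 4, 5, 6 :: 6] 6 = 2"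
  by simp_all

lemma bij_cycle_of_list: "bij (cycle_of_list cs)"
  using cycle_permutes permutes_bij by blast

text \<open>The bracketing exhibits the fourth power of the 5-cycle as its right inverse, which is
  how \<open>perm1_surj\<close> cancels a factor.\<close>

lemma cycle_5_power:
  "cycle_of_list [2, 3, 4, 5, 6 :: 6] \<circ> (cycle_of_list [2, 3, 4, 5, 6] \<circ> cycle_of_list [2, 3, 4, 5, 6] \<circ>
   cycle_of_list [2, 3, 4, 5, 6] \<circ> cycle_of_list [2, 3, 4, 5, 6]) = id"
  unfolding fun_eq_iff forall_6 by (simp only: o_apply cycle_5 id_apply simp_thms)

text \<open>Permutations are encoded by their lists of images instead of cycles, so that a product
  of explicit elements is verified index by index on literal lists.\<close>

definition mono_pair where
  "mono_pair ds xs es ys e =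
    (mono6 ds (\<lambda>i. vector xs $ i), mono6 es (\<lambda>i. vector ys $ i), e :: bool)"

lemma mono6_mult:
  assumes "\<forall>i::6. vector ds $ i * (if e then cnj (vector ds' $ (vector xs $ i)) else vector ds' $ (vector xs $ i)) =
      vector ds'' $ i"
    and "\<forall>i::6. (vector xs' :: 6^6) $ (vector xs $ i) = vector xs'' $ i"
  shows "mono6 ds (\<lambda>i. vector xs $ i) ** conj_if e (mono6 ds' (\<lambda>i. vector xs' $ i)) =
    mono6 ds'' (\<lambda>i. vector xs'' $ i)"
proof -
  have "(\<chi> i. vector ds $ i * (\<chi> i. if e then cnj (vector ds' $ i) else vector ds' $ i) $ (vector xs $ i)) =
      (vector ds'' :: complex^6)"
    using assms(1) by (simp add: vec_eq_iff)
  moreover have "(\<lambda>i. (vector xs' :: 6^6) $ i) \<circ> (\<lambda>i::6. vector xs $ i) = (\<lambda>i. vector xs'' $ i)"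
    using assms(2) by (simp add: fun_eq_iff)
  ultimately show ?thesis
    unfolding mono6_def conj_if_monom_mat monom_mat_mult by (simp only:)
qed

lemma mono_pair_mult:
  assumes "\<forall>i::6. vector ds $ i * (if e then cnj (vector ds' $ (vector xs $ i)) else vector ds' $ (vector xs $ i)) =
      vector ds'' $ i"
    and "\<forall>i::6. (vector xs' :: 6^6) $ (vector xs $ i) = vector xs'' $ i"
    and "\<forall>i::6. vector es $ i * (if e then cnj (vector es' $ (vector ys $ i)) else vector es' $ (vector ys $ i)) =
      vector es'' $ i"
    and "\<forall>i::6. (vector ys' :: 6^6) $ (vector ys $ i) = vector ys'' $ i"
    and "e'' \<longleftrightarrow> e \<noteq> e'"
  shows "mono_pair ds xs es ys e \<otimes>\<^bsub>GL_pair_star\<^esub> mono_pair ds' xs' es' ys' e' =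
    mono_pair ds'' xs'' es'' ys'' e''"
  unfolding mono_pair_def mult_GL_pair_star
  using mono6_mult[OF assms(1,2)] mono6_mult[OF assms(3,4)] assms(5) by simp

lemma carrier_X_group: "carrier (X_group \<omega>) = generate GL_pair_star {tau1, tau2 \<omega>, star}"
  by (simp add: X_group_def)

section \<open>The automorphism group of the Hadamard matrix\<close>

locale primitive_cube_root =
  fixes \<omega> :: complex
  assumes root: "primitive_root_of_unity 3 \<omega>"
begin

lemma omega_power3: "\<omega> ^ 3 = 1"
  using root by (simp add: primitive_root_of_unity_def)

lemma omega_neq_1: "\<omega> \<noteq> 1"
  using root unfolding primitive_root_of_unity_def by (metis one_less_numeral_iff power_one_right semiring_norm(77) zero_less_one)

lemma norm_omega: "norm \<omega> = 1"
  using omega_power3 by (metis norm_ge_zero norm_one norm_power power_eq_1_iff zero_neq_numeral)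

text \<open>As rewrite rules these form the multiplication table of the cube roots of unity, which
  lets simplification decide the entrywise matrix identities below.\<close>

lemma omega_mult [simp]:
  "\<omega> * cnj \<omega> = 1" "cnj \<omega> * \<omega> = 1" "\<omega> * \<omega> = cnj \<omega>" "cnj \<omega> * cnj \<omega> = \<omega>"
proof -
  show 1: "\<omega> * cnj \<omega> = 1" by (simp add: norm_omega flip: complex_norm_square)
  then show 2: "cnj \<omega> * \<omega> = 1" by (simp add: mult.commute)
  show 3: "\<omega> * \<omega> = cnj \<omega>"
    using omega_power3 1 by (metis mult.assoc mult_1 mult.right_neutral power3_eq_cube mult.commute)
  show "cnj \<omega> * cnj \<omega> = \<omega>"
    using arg_cong[OF 3, of cnj] by simp
qed

text \<open>Multiplying \<open>1 + \<omega> + cnj \<omega>\<close> by the nonzero factor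
  \<open>\<omega> - 1\<close> telescopes to 0.\<close>

lemma omega_sum: "cnj \<omega> = - 1 - \<omega>"
proof -
  have "(\<omega> - 1) * (1 + \<omega> + cnj \<omega>) = 0"
    by (simp add: algebra_simps)
  then have "1 + \<omega> + cnj \<omega> = 0" using omega_neq_1 by simp
  then show ?thesis by (auto simp: complex_eq_iff)
qed

lemma omega_neq [simp]:
  "\<omega> \<noteq> 1" "\<omega> \<noteq> 0" "cnj \<omega> \<noteq> 1" "cnj \<omega> \<noteq> \<omega>" "1 \<noteq> \<omega>" "1 \<noteq> cnj \<omega>" "\<omega> \<noteq> cnj \<omega>"
proof -
  show 1: "\<omega> \<noteq> 1" "\<omega> \<noteq> 0" "cnj \<omega> \<noteq> 1" using omega_neq_1 norm_omega by auto
  show 2: "cnj \<omega> \<noteq> \<omega>" using omega_mult(3) 1 by (metis mult_cancel_left1)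
  show "1 \<noteq> \<omega>" "1 \<noteq> cnj \<omega>" "\<omega> \<noteq> cnj \<omega>" using 1 2 by auto
qed

abbreviation H where "H \<equiv> H6 \<omega>"
abbreviation G where "G \<equiv> Aut_star_H6 \<omega>"

lemma H6_nth:
  "H $ 1 = vector [1, 1, 1, 1, 1, 1]"
  "H $ 2 = vector [1, 1, \<omega>, cnj \<omega>, cnj \<omega>, \<omega>]"
  "H $ 3 = vector [1, \<omega>, 1, \<omega>, cnj \<omega>, cnj \<omega>]"
  "H $ 4 = vector [1, cnj \<omega>, \<omega>, 1, \<omega>, cnj \<omega>]"
  "H $ 5 = vector [1, cnj \<omega>, cnj \<omega>, \<omega>, 1, \<omega>]"
  "H $ 6 = vector [1, \<omega>, cnj \<omega>, cnj \<omega>, \<omega>, 1]"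
  by (simp_all add: H6_def)

lemma H6_symmetric: "H $ i $ j = H $ j $ i"
proof -
  have "\<forall>i j. H $ i $ j = H $ j $ i"
    unfolding forall_6 H6_nth by simp
  then show ?thesis by blast
qed

lemma norm_H6: "cnj (H $ i $ j) * H $ i $ j = 1" "H $ i $ j * cnj (H $ i $ j) = 1"
proof -
  have "\<forall>i j. cnj (H $ i $ j) * H $ i $ j = 1"
    unfolding forall_6 H6_nth by simp
  then show "cnj (H $ i $ j) * H $ i $ j = 1" by blast
  then show "H $ i $ j * cnj (H $ i $ j) = 1" by (simp add: mult.commute)
qed

lemma H6_unitary: "H ** map_matrix cnj (transpose H) = mat 6"
proof -
  have "\<forall>i j. (H ** map_matrix cnj (transpose H)) $ i $ j = mat 6 $ i $ j"
    unfolding forall_6 matrix_matrix_mult_def mat_def transpose_def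
    by (simp add: sum_6 H6_nth) (simp add: omega_sum)
  then show ?thesis by (simp add: vec_eq_iff)
qed

lemma tau_monom_mat:
  "tau1 = (monom_mat (\<chi> i. 1) (cycle_of_list [2, 3, 4, 5, 6]),
    monom_mat (\<chi> i. 1) (cycle_of_list [2, 3, 4, 5, 6]), False)"
  "star = (monom_mat (\<chi> i. 1) id, monom_mat (\<chi> i. 1) id, True)"
  unfolding tau1_def mono6_def star_def monom_mat_id
  by (simp_all add: monom_mat_eq vec_eq_iff forall_6)

lemma generators_cube_monomial: "{tau1, tau2 \<omega>, star} \<subseteq> {x. cube_monomial x}"
proof -
  have "\<forall>i. (vector [1, 1, \<omega>, cnj \<omega>, cnj \<omega>, \<omega>] :: complex^6) $ i ^ 3 = 1"
    "\<forall>i. (vector [1, 1, cnj \<omega>, \<omega>, \<omega>, cnj \<omega>] :: complex^6) $ i ^ 3 = 1"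
    by (simp_all add: forall_6 omega_power3 flip: complex_cnj_power)
  then have "cube_monomial (tau2 \<omega>)"
    unfolding tau2_def mono6_def by (intro cube_monomialI bij_comp bij_cycle_of_list) auto
  moreover have "cube_monomial tau1" "cube_monomial star"
    unfolding tau_monom_mat by (intro cube_monomialI bij_cycle_of_list bij_id; simp)+
  ultimately show ?thesis by simp
qed

lemma subgroup_Aut_star_H6: "subgroup (carrier G) GL_pair_star"
  and Aut_star_H6_cube_monomial: "x \<in> carrier G \<Longrightarrow> cube_monomial x"
proof -
  interpret group "GL_pair_star :: 6 pair_star monoid" by (rule group_GL_pair_star)
  have carr: "{tau1, tau2 \<omega>, star} \<subseteq> carrier GL_pair_star"
    using generators_cube_monomial subgroup.subset[OF subgroup_cube_monomial] by blast
  note sub = generate_is_subgroup[OF carr]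
  \<comment> \<open>The group is the intersection of two subgroups, the generated one and the
    stabiliser.\<close>
  have eq: "carrier G = generate GL_pair_star {tau1, tau2 \<omega>, star} \<inter>
      {x \<in> carrier GL_pair_star. star_action H x = H}"
    using subgroup.subset[OF sub] by (auto simp: Aut_star_H6_def carrier_X_group)
  show "subgroup (carrier G) GL_pair_star"
    unfolding eq by (intro subgroups_Inter_pair sub subgroup_star_action_stabiliser)
  show "cube_monomial x" if "x \<in> carrier G"
    using that generate_subgroup_incl[OF generators_cube_monomial subgroup_cube_monomial]
    unfolding eq by blast
qed

lemma Aut_star_H6_eq: "G = GL_pair_star\<lparr>carrier := carrier G\<rparr>"
  by (simp add: Aut_star_H6_def X_group_def)

lemma group_Aut_star_H6: "group G"
  using subgroup.subgroup_is_group[OF subgroup_Aut_star_H6 group_GL_pair_star] Aut_star_H6_eq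
  by simp

lemma Aut_star_H6_ops:
  "x \<otimes>\<^bsub>G\<^esub> y = x \<otimes>\<^bsub>GL_pair_star\<^esub> y" "\<one>\<^bsub>G\<^esub> = (mat 1, mat 1, False)"
  by (simp_all add: Aut_star_H6_def X_group_def one_GL_pair_star)

text \<open>Working form of membership: monomial components together with the entrywise stabiliser
  equation.\<close>

lemma Aut_star_H6_E:
  assumes "x \<in> carrier G"
  obtains p \<sigma> q \<tau> e where "x = (monom_mat p \<sigma>, monom_mat q \<tau>, e)" "bij \<sigma>" "bij \<tau>"
    "\<And>i. p $ i ^ 3 = 1" "\<And>i. q $ i ^ 3 = 1" "\<And>i. p $ i \<noteq> 0" "\<And>i. q $ i \<noteq> 0"
    "\<And>i k. H $ i $ k * q $ k = p $ i * conj_if e H $ \<sigma> i $ \<tau> k"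
proof -
  have fixed: "star_action H x = H"
    using assms by (simp add: Aut_star_H6_def)
  obtain p \<sigma> q \<tau> e where x: "x = (monom_mat p \<sigma>, monom_mat q \<tau>, e)" "bij \<sigma>" "bij \<tau>"
    "\<forall>i. p $ i ^ 3 = 1" "\<forall>i. q $ i ^ 3 = 1"
    using Aut_star_H6_cube_monomial[OF assms] unfolding cube_monomial_def by blast
  moreover have "p $ i \<noteq> 0" "q $ i \<noteq> 0" for i
    using x(4,5) cube_root_1_nonzero by blast+
  ultimately show thesis
    using that fixed star_action_fixed_monom_mat_iff[of \<sigma> \<tau> p H q e] by blast
qed

lemma tau1_in_Aut: "tau1 \<in> carrier G"
proof -
  have "star_action H tau1 = H"
    unfolding tau_monom_mat
    by (subst star_action_fixed_monom_mat_iff, (rule bij_cycle_of_list)+)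
      (simp_all add: forall_6 H6_nth)
  then show ?thesis
    unfolding Aut_star_H6_def carrier_X_group by (auto intro: generate.incl)
qed

text \<open>\<open>tau2\<close> maps \<open>H\<close> to its complex conjugate, so it is outside the
  stabiliser; the following \<open>star\<close> brings the result back to \<open>H\<close>.\<close>

abbreviation tau2_star where "tau2_star \<equiv> tau2 \<omega> \<otimes>\<^bsub>GL_pair_star\<^esub> star"

lemma tau2_star_eq: "tau2_star = (mono6 [1, 1, \<omega>, cnj \<omega>, cnj \<omega>, \<omega>] (cycle_of_list [1, 2]),
   mono6 [1, 1, cnj \<omega>, \<omega>, \<omega>, cnj \<omega>] (cycle_of_list [1, 2] \<circ> cycle_of_list [3, 6] \<circ> cycle_of_list [4, 5]),
   True)"
  by (simp add: tau2_def star_def mult_GL_pair_star)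

lemma tau2_star_in_Aut: "tau2_star \<in> carrier G"
proof -
  have nz: "\<And>i. (vector [1, 1, \<omega>, cnj \<omega>, cnj \<omega>, \<omega>] :: complex^6) $ i \<noteq> 0"
    using forall_6[of "\<lambda>i. (vector [1, 1, \<omega>, cnj \<omega>, cnj \<omega>, \<omega>] :: complex^6) $ i \<noteq> 0"] by simp
  have 1: "(cycle_of_list [1, 2] \<circ> cycle_of_list [3, 6] \<circ> cycle_of_list [4, 5] :: 6 \<Rightarrow> 6) = (\<lambda>i. vector [2, 1, 6, 5, 4, 3] $ i)"
    "(cycle_of_list [1, 2] :: 6 \<Rightarrow> 6) = (\<lambda>i. vector [2, 1, 3, 4, 5, 6] $ i)"
    unfolding fun_eq_iff forall_6 by simp_all
  have "star_action H tau2_star = H"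
    unfolding tau2_star_eq mono6_def
    by (subst star_action_fixed_monom_mat_iff, (intro bij_comp bij_cycle_of_list)+, rule nz)
      (simp add: 1 forall_6 conj_if_def H6_nth)
  then show ?thesis
    unfolding Aut_star_H6_def carrier_X_group
    by (auto intro: generate.incl generate.eng)
qed

section \<open>Rigidity of the Hadamard matrix under monomial column operations\<close>

lemma H6_1: "H $ i $ 1 = 1" "H $ 1 $ i = 1"
  using exhaust_6[of i] by (auto simp: H6_nth)

lemma H6_columns:
  assumes eq: "\<And>i k. H $ i $ k = conj_if e (map_matrix cnj H) $ i $ m * conj_if e H $ i $ \<tau> k"
  shows "\<tau> = id" "\<not> e"
proof -
  \<comment> \<open>Replacing \<open>\<tau> k\<close> by an unspecified column \<open>l\<close>,
    chosen for each \<open>k\<close> separately, leaves a finite check over \<open>m\<close> and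
    \<open>l\<close>. A few columns \<open>k\<close> already exclude the unwanted cases.\<close>
  have *: "\<forall>k. \<exists>l. \<forall>i. H $ i $ k = conj_if e (map_matrix cnj H) $ i $ m * conj_if e H $ i $ l"
    using eq by blast
  have "\<not> e"
  proof
    assume e
    then have "\<exists>l. \<forall>i. H $ i $ k = H $ i $ m * cnj (H $ i $ l)" for k
      using * by (simp add: conj_if_def)
    from this[of 1] this[of 2] this[of 3] show False
      using exhaust_6[of m]
      by (elim disjE; simp add: forall_6 ex_6 H6_nth)
  qed
  moreover have "m = 1"
  proof -
    have "\<exists>l. \<forall>i. H $ i $ k = cnj (H $ i $ m) * H $ i $ l" for k
      using * \<open>\<not> e\<close> by simp
    from this[of 2] this[of 3] show ?thesis
      using exhaust_6[of m] 
      by (elim disjE; simp add: forall_6 ex_6 H6_nth)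
  qed
  \<comment> \<open>Column 1 is constant, so column \<open>k\<close> equals column
    \<open>\<tau> k\<close>; the columns of \<open>H\<close> are pairwise distinct.\<close>
  moreover have "\<tau> k = k" for k
  proof -
    have "\<forall>i. H $ i $ k = H $ i $ \<tau> k"
      using eq[of _ k] \<open>\<not> e\<close> \<open>m = 1\<close> by (simp add: H6_1)
    then show ?thesis
      using exhaust_6[of k] exhaust_6[of "\<tau> k"] 
      by (elim disjE; simp add: forall_6 H6_nth)
  qed
  ultimately show "\<tau> = id" "\<not> e" by auto
qed

text \<open>The first row of \<open>H\<close> is constant, which makes \<open>b\<close> constant.
  The first column is constant too, which expresses \<open>a\<close> through column
  \<open>\<tau> 1\<close>. Substituting both leaves the hypothesis of \<open>H6_columns\<close> with
  \<open>m = \<tau> 1\<close>.\<close>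

lemma H6_monomial_kernel:
  assumes eq: "\<And>i k. H $ i $ k * b k = a i * conj_if e H $ i $ \<tau> k"
    and nz: "\<And>i. a i \<noteq> 0" "\<And>k. b k \<noteq> 0"
  shows "\<tau> = id" "\<not> e" "b k = b 1" "a i = b 1"
proof -
  have cH1: "conj_if e H $ 1 $ i = 1" for i
    by (simp add: conj_if_def H6_1)
  have ceq: "conj_if e (map_matrix cnj H) $ i $ k * conj_if e H $ i $ k = 1" for i k
    by (simp add: conj_if_def norm_H6)
  have b: "b k = b 1" for k
    using eq[of 1 k] eq[of 1 1] by (simp add: H6_1 cH1)
  have a: "a i = b 1 * conj_if e (map_matrix cnj H) $ i $ \<tau> 1" for i
  proof -
    have "a i = (a i * conj_if e H $ i $ \<tau> 1) * conj_if e (map_matrix cnj H) $ i $ \<tau> 1"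
      using ceq[of i "\<tau> 1"] by (simp add: mult_ac)
    then show ?thesis
      using eq[of i 1] by (simp add: H6_1)
  qed
  have "H $ i $ k = conj_if e (map_matrix cnj H) $ i $ \<tau> 1 * conj_if e H $ i $ \<tau> k" for i k
    using eq[of i k] nz(2)[of 1] by (simp add: a b[of k] mult_ac)
  note 1 = H6_columns[OF this]
  show "\<tau> = id" "\<not> e" "b k = b 1" by (fact 1 b)+
  show "a i = b 1" using a[of i] 1 by (simp add: H6_1)
qed

section \<open>Lifts of two disjoint 3-cycles and their commutator\<close>

lemma tau1_mono_pair:
  "tau1 = mono_pair [1, 1, 1, 1, 1, 1] [1, 3, 4, 5, 6, 2] [1, 1, 1, 1, 1, 1] [1, 3, 4, 5, 6, 2] False"
proof -
  have "cycle_of_list [2, 3, 4, 5, 6] = (\<lambda>i. vector [1, 3, 4, 5, 6, 2] $ i :: 6)"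
    unfolding fun_eq_iff forall_6 by (simp del: cycle_of_list.simps)
  then show ?thesis by (simp only: tau1_def mono_pair_def)
qed

lemma tau2_star_mono_pair:
  "tau2_star = mono_pair [1, 1, \<omega>, cnj \<omega>, cnj \<omega>, \<omega>] [2, 1, 3, 4, 5, 6] [1, 1, cnj \<omega>, \<omega>, \<omega>, cnj \<omega>] [2, 1, 6, 5, 4, 3] True"
proof -
  have "(cycle_of_list [1, 2] \<circ> cycle_of_list [3, 6] \<circ> cycle_of_list [4, 5] :: 6 \<Rightarrow> 6) = (\<lambda>i. vector [2, 1, 6, 5, 4, 3] $ i)"
    "(cycle_of_list [1, 2] :: 6 \<Rightarrow> 6) = (\<lambda>i. vector [2, 1, 3, 4, 5, 6] $ i)"
    unfolding fun_eq_iff forall_6 by simp_all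
  then show ?thesis by (simp only: tau2_star_eq mono_pair_def)
qed

text \<open>
  With \<open>a = tau1\<close>, \<open>b = tau2_star\<close> and \<open>c = b a b\<close>, these are \<open>c a\<^sup>3 c a\<close> and \<open>a\<^sup>4 c\<close>; the suffix
  names the 3-cycle of the first component.
\<close>

definition lift456 where
  "lift456 = mono_pair [1, \<omega>, cnj \<omega>, cnj \<omega>, \<omega>, 1] [1, 2, 3, 5, 6, 4] [1, 1, 1, 1, 1, 1] [4, 5, 2, 6, 3, 1] False"

definition lift123 where
  "lift123 = mono_pair [cnj \<omega>, \<omega>, 1, cnj \<omega>, 1, \<omega>] [3, 1, 2, 4, 5, 6] [\<omega>, \<omega>, 1, cnj \<omega>, cnj \<omega>, 1] [6, 5, 2, 1, 3, 4] False"

definition omega_scalar :: "6 pair_star" where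
  "omega_scalar = (mat \<omega>, mat \<omega>, False)"

lemma Aut_mult: "x \<in> carrier G \<Longrightarrow> y \<in> carrier G \<Longrightarrow> x \<otimes>\<^bsub>GL_pair_star\<^esub> y \<in> carrier G"
  by (rule subgroup.m_closed[OF subgroup_Aut_star_H6])

lemma Aut_mult_eq:
  "x \<in> carrier G \<Longrightarrow> y \<in> carrier G \<Longrightarrow> x \<otimes>\<^bsub>GL_pair_star\<^esub> y = z \<Longrightarrow> z \<in> carrier G"
  using Aut_mult by blast

text \<open>The two words in \<open>tau1\<close> and \<open>tau2_star\<close> are evaluated factor
  by factor; every intermediate product is written out and confirmed by
  \<open>mono_pair_mult\<close>.\<close>

lemma lift_in_Aut: "lift456 \<in> carrier G" "lift123 \<in> carrier G"
proof -
  note a = tau1_in_Aut[unfolded tau1_mono_pair] and b = tau2_star_in_Aut[unfolded tau2_star_mono_pair]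
  have ba: "mono_pair [1, 1, \<omega>, cnj \<omega>, cnj \<omega>, \<omega>] [3, 1, 4, 5, 6, 2] [1, 1, cnj \<omega>, \<omega>, \<omega>, cnj \<omega>] [3, 1, 2, 6, 5, 4] True \<in> carrier G"
    by (rule Aut_mult_eq[OF b a mono_pair_mult]) (simp_all add: forall_6)
  have c: "mono_pair [cnj \<omega>, 1, cnj \<omega>, 1, \<omega>, \<omega>] [3, 2, 4, 5, 6, 1] [\<omega>, 1, cnj \<omega>, cnj \<omega>, 1, \<omega>] [6, 2, 1, 3, 4, 5] False \<in> carrier G"
    by (rule Aut_mult_eq[OF ba b mono_pair_mult]) (simp_all add: forall_6)
  have a2: "mono_pair [1, 1, 1, 1, 1, 1] [1, 4, 5, 6, 2, 3] [1, 1, 1, 1, 1, 1] [1, 4, 5, 6, 2, 3] False \<in> carrier G"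
    by (rule Aut_mult_eq[OF a a mono_pair_mult]) (simp_all add: forall_6)
  have a3: "mono_pair [1, 1, 1, 1, 1, 1] [1, 5, 6, 2, 3, 4] [1, 1, 1, 1, 1, 1] [1, 5, 6, 2, 3, 4] False \<in> carrier G"
    by (rule Aut_mult_eq[OF a2 a mono_pair_mult]) (simp_all add: forall_6)
  have a4: "mono_pair [1, 1, 1, 1, 1, 1] [1, 6, 2, 3, 4, 5] [1, 1, 1, 1, 1, 1] [1, 6, 2, 3, 4, 5] False \<in> carrier G"
    by (rule Aut_mult_eq[OF a3 a mono_pair_mult]) (simp_all add: forall_6)
  have ca3: "mono_pair [cnj \<omega>, 1, cnj \<omega>, 1, \<omega>, \<omega>] [6, 5, 2, 3, 4, 1] [\<omega>, 1, cnj \<omega>, cnj \<omega>, 1, \<omega>] [4, 5, 1, 6, 2, 3] False \<in> carrier G"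
    by (rule Aut_mult_eq[OF c a3 mono_pair_mult]) (simp_all add: forall_6)
  have d: "mono_pair [1, \<omega>, cnj \<omega>, cnj \<omega>, \<omega>, 1] [1, 6, 2, 4, 5, 3] [1, 1, 1, 1, 1, 1] [3, 4, 6, 5, 2, 1] False \<in> carrier G"
    by (rule Aut_mult_eq[OF ca3 c mono_pair_mult]) (simp_all add: forall_6)
  have X: "mono_pair [1, \<omega>, cnj \<omega>, cnj \<omega>, \<omega>, 1] [1, 2, 3, 5, 6, 4] [1, 1, 1, 1, 1, 1] [4, 5, 2, 6, 3, 1] False \<in> carrier G"
    by (rule Aut_mult_eq[OF d a mono_pair_mult]) (simp_all add: forall_6)
  have Y: "mono_pair [cnj \<omega>, \<omega>, 1, cnj \<omega>, 1, \<omega>] [3, 1, 2, 4, 5, 6] [\<omega>, \<omega>, 1, cnj \<omega>, cnj \<omega>, 1] [6, 5, 2, 1, 3, 4] False \<in> carrier G"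
    by (rule Aut_mult_eq[OF a4 c mono_pair_mult]) (simp_all add: forall_6)
  show "lift456 \<in> carrier G" "lift123 \<in> carrier G"
    unfolding lift456_def lift123_def by (fact X Y)+
qed

text \<open>The commutator relation is put in a form without inverses: both products have the same
  permutations in each component, and their diagonals differ by the factor
  \<open>\<omega>\<close>.\<close>

lemma lift_commutator:
  "lift456 \<otimes>\<^bsub>GL_pair_star\<^esub> lift123 =
   omega_scalar \<otimes>\<^bsub>GL_pair_star\<^esub> (lift123 \<otimes>\<^bsub>GL_pair_star\<^esub> lift456)"
proof -
  let ?I = "[1, 2, 3, 4, 5, 6] :: 6 list" and ?w = "[\<omega>, \<omega>, \<omega>, \<omega>, \<omega>, \<omega>]"
  have "(vector ?w :: complex^6) = (\<chi> i. \<omega>)" "(\<lambda>i. (vector ?I :: 6^6) $ i) = id"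
    by (simp_all add: vec_eq_iff fun_eq_iff forall_6)
  then have z: "omega_scalar = mono_pair ?w ?I ?w ?I False"
    by (simp only: omega_scalar_def mono_pair_def mono6_def monom_mat_id)
  have 1: "lift456 \<otimes>\<^bsub>GL_pair_star\<^esub> lift123 = mono_pair [cnj \<omega>, cnj \<omega>, cnj \<omega>, cnj \<omega>, cnj \<omega>, cnj \<omega>] [3, 1, 2, 5, 6, 4] [cnj \<omega>, cnj \<omega>, \<omega>, 1, 1, \<omega>] [1, 3, 5, 4, 2, 6] False"
    unfolding lift456_def lift123_def by (rule mono_pair_mult) (simp_all add: forall_6)
  have 2: "lift123 \<otimes>\<^bsub>GL_pair_star\<^esub> lift456 = mono_pair [\<omega>, \<omega>, \<omega>, \<omega>, \<omega>, \<omega>] [3, 1, 2, 5, 6, 4] [\<omega>, \<omega>, 1, cnj \<omega>, cnj \<omega>, 1] [1, 3, 5, 4, 2, 6] False"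
    unfolding lift456_def lift123_def by (rule mono_pair_mult) (simp_all add: forall_6)
  show ?thesis
    unfolding 1 2 z by (rule mono_pair_mult[symmetric]) (simp_all add: forall_6)
qed

text \<open>Fixing \<open>H\<close> is not enough for membership; the scalar must also be generated
  by \<open>tau1\<close>, \<open>tau2\<close> and \<open>star\<close>. It is, being the commutator
  of two elements of the group.\<close>

lemma omega_scalar_in_Aut: "omega_scalar \<in> carrier G"
proof -
  interpret group "GL_pair_star :: 6 pair_star monoid" by (rule group_GL_pair_star)
  note Aut = subgroup_Aut_star_H6 lift_in_Aut
  let ?yx = "lift123 \<otimes>\<^bsub>GL_pair_star\<^esub> lift456"
  have "omega_scalar \<in> carrier GL_pair_star"
    unfolding omega_scalar_def carrier_GL_pair_star monom_mat_id[symmetric]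
    by (auto intro!: invertible_monom_mat ring_unit_field)
  moreover have "?yx \<in> carrier G" using Aut by (intro Aut_mult)
  moreover have "?yx \<in> carrier GL_pair_star" using \<open>?yx \<in> carrier G\<close> subgroup.subset[OF Aut(1)] by blast
  ultimately have "omega_scalar = (omega_scalar \<otimes>\<^bsub>GL_pair_star\<^esub> ?yx) \<otimes>\<^bsub>GL_pair_star\<^esub> inv\<^bsub>GL_pair_star\<^esub> ?yx"
    by (simp add: m_assoc)
  also have "\<dots> \<in> carrier G"
    unfolding lift_commutator[symmetric] using Aut \<open>?yx \<in> carrier G\<close>
    by (intro Aut_mult subgroup.m_inv_closed)
  finally show ?thesis .
qed

end

section \<open>The two representations\<close>

lemma sq_of_complex_0 [simp]: "sq_of_complex 0 = 0"
  by (simp add: split_quat_defs)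

lemma sq_of_complex_sum: "sq_of_complex (sum f A) = (\<Sum>x\<in>A. sq_of_complex (f x))"
  by (induction A rule: infinite_finite_induct) (simp_all add: sq_of_complex_hom)

lemma sq_matrix_mult: "sq_matrix (A ** B) = sq_matrix A ** sq_matrix B"
  by (simp add: vec_eq_iff matrix_matrix_mult_def sq_of_complex_sum sq_of_complex_hom)

lemma sq_matrix_mat_1: "sq_matrix (mat 1) = mat 1"
  by (simp add: vec_eq_iff mat_def sq_of_complex_hom)

text \<open>This is \<beta> to the power \<open>e\<close>; since \<beta> squares to 1, exponents add
  modulo 2.\<close>

definition beta_if :: "bool \<Rightarrow> split_quat" where
  "beta_if e = (if e then sq_beta else 1)"

lemma beta_if_mult: "beta_if e * beta_if e' = beta_if (e \<noteq> e')"
  by (simp add: beta_if_def sq_beta_square)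

lemma ring_unit_sq_of_complex_beta_if:
  assumes "z \<noteq> 0"
  shows "ring_unit (sq_of_complex z * beta_if e)"
proof (rule ring_unit_mult)
  have "sq_of_complex z * sq_of_complex (inverse z) = 1" "sq_of_complex (inverse z) * sq_of_complex z = 1"
    using assms by (simp_all add: sq_of_complex_hom flip: sq_of_complex_hom(3))
  then show "ring_unit (sq_of_complex z)"
    unfolding ring_unit_def by blast
  show "ring_unit (beta_if e)"
    unfolding ring_unit_def beta_if_def using sq_beta_square by (cases e) auto
qed

lemma mat_matrix_mult: "(mat c ** (A :: 'a::ring_1^'m^'n)) $ i $ j = c * A $ i $ j"
  by (simp add: monom_mat_matrix_mult flip: monom_mat_id)

lemma matrix_mat_mult: "((A :: 'a::ring_1^'m^'n) ** mat c) $ i $ j = A $ i $ j * c"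
  using matrix_mult_monom_mat[of id A "\<chi> i. c" i j] by (simp add: monom_mat_id)

text \<open>Entrywise this is \<beta> z = \<open>cnj z\<close> \<beta>. It turns the conjugation of
  the semidirect product into matrix multiplication and makes \<open>rho1\<close> and
  \<open>rho2\<close> multiplicative.\<close>

lemma mat_beta_if_commute: "mat (beta_if e) ** sq_matrix A = sq_matrix (conj_if e A) ** mat (beta_if e)"
  by (simp add: vec_eq_iff mat_matrix_mult matrix_mat_mult beta_if_def conj_if_def split_quat_defs)

lemma rho_beta_if:
  "rho1 (P, Q, e) = sq_matrix P ** mat (beta_if e)"
  "rho2 (P, Q, e) = sq_matrix Q ** mat (beta_if e)"
  by (simp_all add: beta_if_def)

lemma sq_matrix_beta_if_mult:
  "sq_matrix (P ** conj_if e P') ** mat (beta_if (e \<noteq> e')) =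
   (sq_matrix P ** mat (beta_if e)) ** (sq_matrix P' ** mat (beta_if e'))"
proof -
  have "(sq_matrix P ** mat (beta_if e)) ** (sq_matrix P' ** mat (beta_if e')) =
      sq_matrix P ** (mat (beta_if e) ** sq_matrix P') ** mat (beta_if e')"
    by (simp only: matrix_mul_assoc)
  also have "\<dots> = sq_matrix P ** sq_matrix (conj_if e P') ** (mat (beta_if e) ** mat (beta_if e'))"
    by (simp only: mat_beta_if_commute matrix_mul_assoc)
  also have "mat (beta_if e) ** mat (beta_if e') = (mat (beta_if (e \<noteq> e')) :: split_quat^'a^'a)"
    by (simp add: vec_eq_iff mat_matrix_mult) (simp add: mat_def beta_if_mult)
  finally show ?thesis by (simp add: sq_matrix_mult)
qed

lemma rho_mult:
  "rho1 (x \<otimes>\<^bsub>GL_pair_star\<^esub> y) = rho1 x ** rho1 y"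
  "rho2 (x \<otimes>\<^bsub>GL_pair_star\<^esub> y) = rho2 x ** rho2 y"
  by (cases x; cases y; simp only: mult_GL_pair_star rho_beta_if sq_matrix_beta_if_mult)+

lemma sq_matrix_monom_mat_beta_if:
  "sq_matrix (monom_mat p \<sigma>) ** mat (beta_if e) =
   monom_mat (\<chi> i. sq_of_complex (p $ i) * beta_if e) \<sigma>"
  by (simp add: map_matrix_monom_mat monom_mat_mult flip: monom_mat_id)

definition perm1 where "perm1 g = underlying_perm (rho1 g)"
definition perm2 where "perm2 g = underlying_perm (rho2 g)"

lemma perm_monom_mat:
  assumes "bij \<sigma>" "\<And>i. p $ i \<noteq> 0"
  shows "perm1 (monom_mat p \<sigma>, Q, e) = \<sigma>" "perm2 (P, monom_mat p \<sigma>, e) = \<sigma>"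
  unfolding perm1_def perm2_def rho_beta_if sq_matrix_monom_mat_beta_if
  by (intro underlying_perm_monom_mat,
      simp_all add: assms ring_unit_nonzero[OF ring_unit_sq_of_complex_beta_if])+

section \<open>The symmetric group and its generation by transpositions\<close>

lemma group_symmetric_group: "group (symmetric_group :: ('n \<Rightarrow> 'n) monoid)"
proof (rule groupI)
  fix \<sigma> :: "'n \<Rightarrow> 'n" assume "\<sigma> \<in> carrier symmetric_group"
  then have "bij \<sigma>" by (simp add: symmetric_group_def)
  then show "\<exists>\<tau>\<in>carrier symmetric_group. \<tau> \<otimes>\<^bsub>symmetric_group\<^esub> \<sigma> = \<one>\<^bsub>symmetric_group\<^esub>"
    by (intro bexI[of _ "inv_into UNIV \<sigma>"])
      (simp_all add: symmetric_group_def bij_imp_bij_inv bij_is_surj surj_iff[symmetric] surj_iff[THEN iffD1])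
qed (auto simp: symmetric_group_def bij_comp o_assoc)

lemma carrier_symmetric_group: "carrier symmetric_group = {\<sigma>. bij \<sigma>}"
  by (simp add: symmetric_group_def)

text \<open>Conjugating the transposition of \<open>a\<close> and \<open>b\<close> by
  \<open>f\<close> gives that of \<open>f a\<close> and \<open>f b\<close>; this form avoids the
  inverse of \<open>f\<close>.\<close>

lemma transpose_conjugate:
  assumes "inj f"
  shows "Transposition.transpose (f a) (f b) \<circ> f = f \<circ> Transposition.transpose a b"
  using assms by (auto simp: fun_eq_iff Transposition.transpose_def inj_eq)

text \<open>The transpositions that move \<open>a\<close> generate all others by conjugation, and
  every permutation of a finite type is a product of transpositions.\<close>

lemma transposition_closed_UNIV:
  fixes T :: "('n::finite \<Rightarrow> 'n) set"
  assumes "id \<in> T" "\<And>\<sigma> \<tau>. \<sigma> \<in> T \<Longrightarrow> \<tau> \<in> T \<Longrightarrow> \<sigma> \<circ> \<tau> \<in> T"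
    and star: "\<And>b. b \<noteq> a \<Longrightarrow> Transposition.transpose a b \<in> T"
    and "bij \<sigma>"
  shows "\<sigma> \<in> T"
proof -
  have tr: "Transposition.transpose b c \<in> T" if "b \<noteq> c" for b c
  proof (cases "b = a \<or> c = a")
    case True
    then show ?thesis using star that by (metis transpose_commute)
  next
    case False
    then have "Transposition.transpose b c =
        Transposition.transpose a b \<circ> Transposition.transpose a c \<circ> Transposition.transpose a b"
      using that by (auto simp: fun_eq_iff Transposition.transpose_def)
    then show ?thesis using False star assms(2) by metis
  qed
  have "\<sigma> permutes UNIV" using \<open>bij \<sigma>\<close> by (intro bij_imp_permutes) auto
  then show ?thesis
    using finite
  proof (induction rule: permutes_induct)
    case id
    show ?case by (rule assms(1))
  next
    case (swap b c p)
    then show ?case by (intro assms(2) tr)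
  qed
qed

definition unit_vec :: "6 \<Rightarrow> split_quat \<Rightarrow> split_quat^6" where
  "unit_vec j x = (\<chi> i. if i = j then x else 0)"

text \<open>Changing two lifts by factors that commute with them does not change their commutator.
  Commutation is assumed for the elements at hand only, because the scalar \<open>\<omega>\<close>
  does not commute with elements that involve conjugation.\<close>

lemma (in group) central_lift_commutator:
  assumes carr: "n \<in> carrier G" "m \<in> carrier G" "z \<in> carrier G" "x \<in> carrier G" "y \<in> carrier G"
    and comm: "n \<otimes> x = x \<otimes> n" "n \<otimes> y = y \<otimes> n" "m \<otimes> x = x \<otimes> m" "m \<otimes> y = y \<otimes> m" "n \<otimes> m = m \<otimes> n"
      "n \<otimes> z = z \<otimes> n" "m \<otimes> z = z \<otimes> m"
    and eq: "(n \<otimes> x) \<otimes> (m \<otimes> y) = z \<otimes> ((m \<otimes> y) \<otimes> (n \<otimes> x))"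
  shows "x \<otimes> y = z \<otimes> (y \<otimes> x)"
proof -
  have "(n \<otimes> m) \<otimes> (x \<otimes> y) = (n \<otimes> x) \<otimes> (m \<otimes> y)"
    using carr by (simp add: m_assoc) (metis comm(3) m_assoc)
  also have "\<dots> = z \<otimes> ((m \<otimes> n) \<otimes> (y \<otimes> x))"
    unfolding eq using carr by (simp add: m_assoc) (metis comm(2) m_assoc)
  also have "\<dots> = (n \<otimes> m) \<otimes> (z \<otimes> (y \<otimes> x))"
    using carr by (metis comm(5-7) m_assoc m_closed)
  finally show ?thesis using carr by simp
qed

context primitive_cube_root
begin

abbreviation S6 :: "(6 \<Rightarrow> 6) monoid" where "S6 \<equiv> symmetric_group"

section \<open>Intertwining and the two permutation homomorphisms\<close>

lemma invertible_H6: "invertible H"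
proof -
  have "mat 6 ** mat (1/6) = (mat 1 :: complex^6^6)"
    by (simp add: vec_eq_iff mat_matrix_mult) (simp add: mat_def)
  then have "H ** (map_matrix cnj (transpose H) ** mat (1/6)) = mat 1"
    by (simp add: matrix_mul_assoc H6_unitary)
  then show ?thesis unfolding invertible_right_inverse by blast
qed

lemma invertible_sq_H6: "invertible (sq_matrix H)"
  using invertible_H6 unfolding invertible_def by (metis sq_matrix_mult sq_matrix_mat_1)

text \<open>Moving \<beta> past \<open>H\<close> undoes the conjugation in
  \<open>H ** Q = P ** conj_if e H\<close>, so the stabiliser condition becomes the intertwining
  relation.\<close>

lemma rho_intertwine:
  assumes "g \<in> carrier G"
  shows "rho1 g = sq_matrix H ** rho2 g ** matrix_inv (sq_matrix H)"
proof -
  obtain P Q e where g: "g = (P, Q, e)" by (metis prod_cases3)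
  have "g \<in> carrier GL_pair_star" "star_action H g = H"
    using assms subgroup.subset[OF subgroup_Aut_star_H6] by (auto simp: Aut_star_H6_def)
  then have "H ** Q = P ** conj_if e H"
    using star_action_fixed_iff unfolding g carrier_GL_pair_star by blast
  then have "sq_matrix H ** rho2 g = sq_matrix P ** (sq_matrix (conj_if e H) ** mat (beta_if e))"
    by (metis g rho_beta_if(2) sq_matrix_mult matrix_mul_assoc)
  also have "\<dots> = rho1 g ** sq_matrix H"
    by (simp only: g rho_beta_if mat_beta_if_commute matrix_mul_assoc[symmetric])
  finally show ?thesis
    using matrix_inv_cancel(1)[OF invertible_sq_H6] by (simp flip: matrix_mul_assoc)
qed

lemma rho_monomial: "monomial_representation G rho1" "monomial_representation G rho2"
proof -
  have *: "invertible (rho1 g)" "monomial_matrix (rho1 g)" "invertible (rho2 g)" "monomial_matrix (rho2 g)"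
    if g_in: "g \<in> carrier G" for g
  proof -
    obtain p \<sigma> q \<tau> e where g: "g = (monom_mat p \<sigma>, monom_mat q \<tau>, e)"
      and "bij \<sigma>" "bij \<tau>" "\<And>i. p $ i \<noteq> 0" "\<And>i. q $ i \<noteq> 0"
      using Aut_star_H6_E[OF g_in] by metis
    then show "invertible (rho1 g)" "monomial_matrix (rho1 g)" "invertible (rho2 g)" "monomial_matrix (rho2 g)"
      unfolding g rho_beta_if sq_matrix_monom_mat_beta_if
      by (auto intro!: invertible_monom_mat monomial_matrix_monom_mat ring_unit_sq_of_complex_beta_if)
  qed
  then show "monomial_representation G rho1" "monomial_representation G rho2"
    unfolding monomial_representation_def matrix_representation_def hom_def
    by (auto simp: GL_def Aut_star_H6_ops rho_mult simp del: rho1.simps rho2.simps)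
qed

lemma perm_hom: "group_hom G S6 perm1" "group_hom G S6 perm2"
proof -
  have *: "bij (perm1 x) \<and> bij (perm2 x) \<and> perm1 (x \<otimes>\<^bsub>G\<^esub> y) = perm1 y \<circ> perm1 x
      \<and> perm2 (x \<otimes>\<^bsub>G\<^esub> y) = perm2 y \<circ> perm2 x" if xy: "x \<in> carrier G" "y \<in> carrier G" for x y
  proof -
    obtain p \<sigma> q \<tau> e where x: "x = (monom_mat p \<sigma>, monom_mat q \<tau>, e)" "bij \<sigma>" "bij \<tau>"
      "\<And>i. p $ i \<noteq> 0" "\<And>i. q $ i \<noteq> 0" using Aut_star_H6_E[OF xy(1)] by metis
    obtain p' \<sigma>' q' \<tau>' e' where y: "y = (monom_mat p' \<sigma>', monom_mat q' \<tau>', e')" "bij \<sigma>'" "bij \<tau>'"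
      "\<And>i. p' $ i \<noteq> 0" "\<And>i. q' $ i \<noteq> 0" using Aut_star_H6_E[OF xy(2)] by metis
    show ?thesis
      unfolding Aut_star_H6_ops x(1) y(1) mult_GL_pair_star conj_if_monom_mat monom_mat_mult
      using x(2-) y(2-) by (simp add: perm_monom_mat bij_comp)
  qed
  show "group_hom G S6 perm1" "group_hom G S6 perm2"
    by (intro group_hom.intro group_hom_axioms.intro group_Aut_star_H6 group_symmetric_group;
        auto simp: hom_def symmetric_group_def *)+
qed

text \<open>A trivial first permutation is the case of \<open>H6_monomial_kernel\<close>. A trivial
  second one reduces to it by inverting the coefficients and exchanging rows with columns, as
  \<open>H\<close> is symmetric. So the two kernels coincide and consist of scalars.\<close>

lemma perm_trivial:
  assumes "x \<in> carrier G" "perm1 x = id \<or> perm2 x = id"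
  shows "perm1 x = id" "perm2 x = id" "\<exists>c. c ^ 3 = 1 \<and> x = (mat c, mat c, False)"
proof -
  obtain p \<sigma> q \<tau> e where x: "x = (monom_mat p \<sigma>, monom_mat q \<tau>, e)" "bij \<sigma>" "bij \<tau>"
    "\<And>i. p $ i ^ 3 = 1" "\<And>i. q $ i ^ 3 = 1" "\<And>i. p $ i \<noteq> 0" "\<And>i. q $ i \<noteq> 0"
    and eq: "\<And>i k. H $ i $ k * q $ k = p $ i * conj_if e H $ \<sigma> i $ \<tau> k"
    using Aut_star_H6_E[OF assms(1)] by metis
  have perm: "perm1 x = \<sigma>" "perm2 x = \<tau>" using x by (simp_all add: perm_monom_mat)
  have "\<sigma> = id \<and> \<tau> = id \<and> \<not> e \<and> (\<exists>c. (\<forall>i. p $ i = c) \<and> (\<forall>i. q $ i = c))"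
  proof (cases "\<sigma> = id")
    case True
    then have "H $ i $ k * q $ k = p $ i * conj_if e H $ i $ \<tau> k" for i k
      using eq[of i k] by simp
    note H6_monomial_kernel[OF this x(6,7)]
    then show ?thesis using True by metis
  next
    case False
    then have "\<tau> = id" using assms(2) perm by simp
    have "H $ k $ i * inverse (p $ i) = inverse (q $ k) * conj_if e H $ k $ \<sigma> i" for i k
    proof -
      have "conj_if e H $ \<sigma> i $ k = conj_if e H $ k $ \<sigma> i"
        using H6_symmetric by (simp add: conj_if_def)
      then show ?thesis
        using eq[of i k] x(6)[of i] x(7)[of k] \<open>\<tau> = id\<close> H6_symmetric[of i k] by (simp add: field_simps)
    qed
    then show ?thesis using H6_monomial_kernel(1)[of "\<lambda>i. inverse (p $ i)" "\<lambda>i. inverse (q $ i)" e \<sigma>] x(6,7) False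
      by simp
  qed
  then obtain c where c: "\<sigma> = id" "\<tau> = id" "\<not> e" "\<And>i. p $ i = c" "\<And>i. q $ i = c" by blast
  then have "p = (\<chi> i. c)" "q = (\<chi> i. c)" by (simp_all add: vec_eq_iff)
  then show "\<exists>c. c ^ 3 = 1 \<and> x = (mat c, mat c, False)"
    using c x(1) x(4)[of 1] by (auto simp: monom_mat_id)
  show "perm1 x = id" "perm2 x = id" using perm c by simp_all
qed

lemma perm1_tau: "perm1 tau1 = cycle_of_list [2, 3, 4, 5, 6]" "perm1 tau2_star = cycle_of_list [1, 2]"
  and perm2_tau2_star: "perm2 tau2_star = cycle_of_list [1, 2] \<circ> cycle_of_list [3, 6] \<circ> cycle_of_list [4, 5]"
proof -
  have nz: "(vector [1, 1, \<omega>, cnj \<omega>, cnj \<omega>, \<omega>] :: complex^6) $ i \<noteq> 0"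
    "(vector [1, 1, cnj \<omega>, \<omega>, \<omega>, cnj \<omega>] :: complex^6) $ i \<noteq> 0" for i
    using exhaust_6[of i] by auto
  show "perm1 tau1 = cycle_of_list [2, 3, 4, 5, 6]"
    unfolding tau_monom_mat by (intro perm_monom_mat bij_cycle_of_list) simp
  show "perm1 tau2_star = cycle_of_list [1, 2]"
    "perm2 tau2_star = cycle_of_list [1, 2] \<circ> cycle_of_list [3, 6] \<circ> cycle_of_list [4, 5]"
    unfolding tau2_star_eq mono6_def by (intro perm_monom_mat bij_cycle_of_list bij_comp nz)+
qed

text \<open>The image contains the transposition of 1 and 2 and a 5-cycle that fixes 1. Conjugating
  by the 5-cycle yields all transpositions that move 1.\<close>

lemma perm1_surj: "perm1 ` carrier G = carrier S6"
proof
  interpret p1: group_hom G S6 perm1 by (rule perm_hom)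
  show "perm1 ` carrier G \<subseteq> carrier S6" by auto
  define T where "T = perm1 ` carrier G"
  define c where "c = cycle_of_list [2, 3, 4, 5, 6 :: 6]"
  note c_nth = cycle_5[folded c_def]
  have comp: "\<tau> \<circ> \<sigma> \<in> T" if "\<sigma> \<in> T" "\<tau> \<in> T" for \<sigma> \<tau>
  proof -
    obtain x y where "x \<in> carrier G" "\<sigma> = perm1 x" "y \<in> carrier G" "\<tau> = perm1 y"
      using \<open>\<sigma> \<in> T\<close> \<open>\<tau> \<in> T\<close> unfolding T_def by blast
    then have "\<tau> \<circ> \<sigma> = perm1 (x \<otimes>\<^bsub>G\<^esub> y)" "x \<otimes>\<^bsub>G\<^esub> y \<in> carrier G"
      by (simp_all only: p1.hom_mult p1.G.m_closed) (simp add: symmetric_group_def)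
    then show ?thesis unfolding T_def by blast
  qed
  have one: "id \<in> T"
  proof -
    have "perm1 \<one>\<^bsub>G\<^esub> = id"
      unfolding p1.hom_one by (simp add: symmetric_group_def)
    then show ?thesis
      unfolding T_def using imageI[OF p1.G.one_closed, of perm1] by (simp only:)
  qed
  have c: "c \<in> T"
    unfolding T_def c_def perm1_tau(1)[symmetric] by (rule imageI[OF tau1_in_Aut])
  have "cycle_of_list [1, 2] \<in> T"
    unfolding T_def perm1_tau(2)[symmetric] by (rule imageI[OF tau2_star_in_Aut])
  then have t: "Transposition.transpose 1 2 \<in> T"
    by (simp only: cycle_of_list.simps comp_id)
  have conj: "Transposition.transpose 1 (c b) \<in> T" if b: "Transposition.transpose 1 b \<in> T" for b
  proof -
    have "Transposition.transpose 1 (c b) \<circ> c = c \<circ> Transposition.transpose 1 b"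
      using transpose_conjugate[OF bij_is_inj[OF bij_cycle_of_list], of "[2, 3, 4, 5, 6 :: 6]" 1 b]
      unfolding c_def[symmetric] c_nth(1) .
    then have "Transposition.transpose 1 (c b) \<circ> (c \<circ> (c \<circ> c \<circ> c \<circ> c)) =
        c \<circ> Transposition.transpose 1 b \<circ> (c \<circ> c \<circ> c \<circ> c)"
      by (simp only: o_assoc)
    then have "Transposition.transpose 1 (c b) = c \<circ> Transposition.transpose 1 b \<circ> (c \<circ> c \<circ> c \<circ> c)"
      unfolding cycle_5_power[folded c_def] by (simp only: comp_id)
    moreover have "c \<circ> Transposition.transpose 1 b \<circ> (c \<circ> c \<circ> c \<circ> c) \<in> T"
      by (intro comp c b)
    ultimately show ?thesis by (simp only:)
  qed
  note t3 = conj[OF t, unfolded c_nth] note t4 = conj[OF t3, unfolded c_nth]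
  note t5 = conj[OF t4, unfolded c_nth] note t6 = conj[OF t5, unfolded c_nth]
  have star: "Transposition.transpose 1 b \<in> T" if "b \<noteq> 1" for b
    using exhaust_6[of b] that t t3 t4 t5 t6 by blast
  show "carrier S6 \<subseteq> perm1 ` carrier G"
    unfolding T_def[symmetric] carrier_symmetric_group
    using transposition_closed_UNIV[OF one comp star] by blast
qed

section \<open>The outer automorphism\<close>

text \<open>Any preimage under \<open>perm1\<close> may be chosen; by \<open>perm_eq_iff\<close> the
  value does not depend on it.\<close>

definition outer where "outer \<sigma> = perm2 (SOME g. g \<in> carrier G \<and> perm1 g = \<sigma>)"

text \<open>The two homomorphisms have the same kernel, and this is applied to the quotient of
  \<open>x\<close> and \<open>y\<close>. One direction makes \<open>outer\<close> well defined, the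
  other makes it injective.\<close>

lemma perm_eq_iff:
  assumes "x \<in> carrier G" "y \<in> carrier G"
  shows "perm1 x = perm1 y \<longleftrightarrow> perm2 x = perm2 y"
proof -
  interpret p1: group_hom G S6 perm1 by (rule perm_hom)
  interpret p2: group_hom G S6 perm2 by (rule perm_hom)
  have one: "\<one>\<^bsub>S6\<^esub> = id" by (simp add: symmetric_group_def)
  have d: "x \<otimes>\<^bsub>G\<^esub> inv\<^bsub>G\<^esub> y \<in> carrier G" using assms by simp
  have iff: "h x = h y \<longleftrightarrow> h (x \<otimes>\<^bsub>G\<^esub> inv\<^bsub>G\<^esub> y) = id" if "group_hom G S6 h" for h
  proof -
    interpret h: group_hom G S6 h by (rule that)
    have "h x = h y \<longleftrightarrow> h x \<otimes>\<^bsub>S6\<^esub> inv\<^bsub>S6\<^esub> (h y) = \<one>\<^bsub>S6\<^esub>"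
      using p1.H.inv_solve_right[of "\<one>\<^bsub>S6\<^esub>" "h x" "h y"] h.hom_closed assms by auto
    then show ?thesis using assms by (simp only: h.hom_mult h.hom_inv p1.G.inv_closed one)
  qed
  show ?thesis
    using iff[OF perm_hom(1)] iff[OF perm_hom(2)] perm_trivial[OF d] by metis
qed

lemma outer_perm1: "g \<in> carrier G \<Longrightarrow> outer (perm1 g) = perm2 g"
  unfolding outer_def by (rule someI2[of _ g]) (auto simp: perm_eq_iff)

lemma outer_graph: "{(perm1 g, perm2 g) | g. g \<in> carrier G} = {(\<sigma>, outer \<sigma>) | \<sigma>. \<sigma> \<in> carrier S6}"
  unfolding perm1_surj[symmetric] using outer_perm1 by (force simp: image_iff)

lemma outer_iso: "outer \<in> iso S6 S6"
proof -
  interpret p1: group_hom G S6 perm1 by (rule perm_hom)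
  interpret p2: group_hom G S6 perm2 by (rule perm_hom)
  have closed: "outer ` carrier S6 \<subseteq> carrier S6"
  proof (rule image_subsetI)
    fix \<sigma> :: "6 \<Rightarrow> 6" assume "\<sigma> \<in> carrier S6"
    then obtain g where "g \<in> carrier G" "\<sigma> = perm1 g"
      unfolding perm1_surj[symmetric] by blast
    then show "outer \<sigma> \<in> carrier S6" by (simp only: outer_perm1 p2.hom_closed)
  qed
  have inj: "inj_on outer (carrier S6)"
    unfolding perm1_surj[symmetric] by (auto simp: inj_on_def outer_perm1 perm_eq_iff)
  have "outer (\<sigma> \<otimes>\<^bsub>S6\<^esub> \<tau>) = outer \<sigma> \<otimes>\<^bsub>S6\<^esub> outer \<tau>" if st: "\<sigma> \<in> carrier S6" "\<tau> \<in> carrier S6" for \<sigma> \<tau>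
  proof -
    obtain x y where "x \<in> carrier G" "\<sigma> = perm1 x" "y \<in> carrier G" "\<tau> = perm1 y"
      using st unfolding perm1_surj[symmetric] by blast
    then show ?thesis
      by (simp add: outer_perm1 flip: p1.hom_mult p2.hom_mult)
  qed
  then have "outer \<in> hom S6 S6" using closed by (auto simp: hom_def)
  moreover have "outer ` carrier S6 = carrier S6"
    by (rule endo_inj_surj[OF finite closed inj])
  ultimately show ?thesis using inj by (simp add: iso_def bij_betw_def)
qed

text \<open>Transpositions have fixed points, but the image of one does not.\<close>

lemma outer_not_inner: "\<not> inner_automorphism S6 outer"
proof
  interpret S6: group S6 by (rule group_symmetric_group)
  let ?t = "cycle_of_list [1, 2 :: 6]" and ?s = "cycle_of_list [1, 2] \<circ> cycle_of_list [3, 6] \<circ> cycle_of_list [4, 5 :: 6]"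
  assume "inner_automorphism S6 outer"
  then obtain a where a: "a \<in> carrier S6" "\<And>x. x \<in> carrier S6 \<Longrightarrow> outer x = inv\<^bsub>S6\<^esub> a \<otimes>\<^bsub>S6\<^esub> x \<otimes>\<^bsub>S6\<^esub> a"
    unfolding inner_automorphism_def by blast
  have t: "?t \<in> carrier S6" unfolding carrier_symmetric_group using bij_cycle_of_list by blast
  have "outer ?t = ?s"
    using outer_perm1[OF tau2_star_in_Aut] unfolding perm1_tau perm2_tau2_star .
  then have "a \<otimes>\<^bsub>S6\<^esub> ?s = a \<otimes>\<^bsub>S6\<^esub> (inv\<^bsub>S6\<^esub> a \<otimes>\<^bsub>S6\<^esub> (?t \<otimes>\<^bsub>S6\<^esub> a))"
    using a t by (simp only: S6.m_assoc S6.inv_closed)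
  also have "\<dots> = ?t \<otimes>\<^bsub>S6\<^esub> a"
    using a t by (metis S6.inv_solve_left S6.m_closed S6.inv_closed)
  \<comment> \<open>Products in \<open>S6\<close> are reversed compositions. As \<open>?t\<close>
    fixes 3, the point \<open>a 3\<close> would be fixed by \<open>?s\<close>.\<close>
  finally have "(?s \<circ> a) 3 = (a \<circ> ?t) 3" by (simp add: symmetric_group_def)
  then have "?s (a 3) = a 3" by simp
  then show False using exhaust_6[of "a 3"] by (elim disjE) (simp_all add: Transposition.transpose_def)
qed

section \<open>The extension\<close>

lemma kernel_perm1: "kernel G S6 perm1 = (\<lambda>c. (mat c, mat c, False)) ` {1, \<omega>, cnj \<omega>}"
proof -
  interpret p1: group_hom G S6 perm1 by (rule perm_hom)
  have one: "\<one>\<^bsub>S6\<^esub> = id" by (simp add: symmetric_group_def)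
  show ?thesis
  proof
    show "kernel G S6 perm1 \<subseteq> (\<lambda>c. (mat c, mat c, False)) ` {1, \<omega>, cnj \<omega>}"
    proof
      fix x assume "x \<in> kernel G S6 perm1"
      then obtain c where c: "c ^ 3 = 1" "x = (mat c, mat c, False)"
        using perm_trivial(3)[of x] by (auto simp: kernel_def one)
      have sum: "\<omega> + cnj \<omega> = - 1"
        by (simp add: omega_sum)
      \<comment> \<open>\<open>c ^ 3 - 1\<close> is factored over the three cube roots of
        unity.\<close>
      have "(c - 1) * ((c - \<omega>) * (c - cnj \<omega>)) = (c - 1) * (c * c - c * (\<omega> + cnj \<omega>) + \<omega> * cnj \<omega>)"
        by (simp add: algebra_simps)
      also have "\<dots> = c ^ 3 - 1"
        by (simp only: sum omega_mult) (simp add: algebra_simps power3_eq_cube)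
      finally show "x \<in> (\<lambda>c. (mat c, mat c, False)) ` {1, \<omega>, cnj \<omega>}"
        using c by auto
    qed
    have w: "omega_scalar \<otimes>\<^bsub>G\<^esub> omega_scalar = (mat (cnj \<omega>), mat (cnj \<omega>), False)"
      by (simp add: Aut_star_H6_ops omega_scalar_def mult_GL_pair_star monom_mat_mult flip: monom_mat_id)
    have "(mat c, mat c, False) \<in> carrier G" if "c \<in> {1, \<omega>, cnj \<omega>}" for c
      using that p1.G.one_closed[unfolded Aut_star_H6_ops] omega_scalar_in_Aut
        p1.G.m_closed[OF omega_scalar_in_Aut omega_scalar_in_Aut, unfolded w]
      by (auto simp: omega_scalar_def)
    moreover have "perm1 (mat c, mat c, False) = id" if "c \<in> {1, \<omega>, cnj \<omega>}" for c
      using that unfolding monom_mat_id[symmetric] by (intro perm_monom_mat) auto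
    ultimately show "(\<lambda>c. (mat c, mat c, False)) ` {1, \<omega>, cnj \<omega>} \<subseteq> kernel G S6 perm1"
      by (auto simp: kernel_def one)
  qed
qed

lemma card_kernel_perm1: "card (kernel G S6 perm1) = 3"
proof -
  have "c = d" if "mat c = (mat d :: complex^6^6)" for c d
    using arg_cong[OF that, of "\<lambda>A. A $ 1 $ 1"] by (simp add: mat_def)
  then have "inj_on (\<lambda>c. (mat c, mat c, False) :: 6 pair_star) {1, \<omega>, cnj \<omega>}"
    by (auto simp: inj_on_def)
  then show ?thesis unfolding kernel_perm1 by (subst card_image) auto
qed

text \<open>Moving a scalar past an element with conjugation would replace it by its conjugate;
  hence the condition on the flag of \<open>x\<close>.\<close>

lemma kernel_perm1_central:
  assumes "n \<in> kernel G S6 perm1" "\<not> snd (snd x)"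
  shows "n \<otimes>\<^bsub>G\<^esub> x = x \<otimes>\<^bsub>G\<^esub> n"
  using assms unfolding kernel_perm1
  by (cases x) (auto simp: Aut_star_H6_ops mult_GL_pair_star vec_eq_iff mat_matrix_mult matrix_mat_mult)

lemma kernel_perm1_snd: "n \<in> kernel G S6 perm1 \<Longrightarrow> \<not> snd (snd n)"
  unfolding kernel_perm1 by auto

text \<open>A complement would contain elements that differ from \<open>lift456\<close> and
  \<open>lift123\<close> by scalars. Their commutator is still \<open>omega_scalar\<close>, so the
  complement would meet the kernel nontrivially.\<close>

lemma nonsplit_extension_kernel_perm1: "nonsplit_extension G (kernel G S6 perm1) S6"
proof -
  interpret p1: group_hom G S6 perm1 by (rule perm_hom)
  define N where "N = kernel G S6 perm1"
  have False if C: "subgroup C G" "C \<inter> N = {\<one>\<^bsub>G\<^esub>}" "N <#>\<^bsub>G\<^esub> C = carrier G" for C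
  proof -
    have N: "n \<in> carrier G" if "n \<in> N" for n
      using that by (simp add: N_def kernel_def)
    have CG: "x \<in> carrier G" if "x \<in> C" for x
      using that subgroup.subset[OF C(1)] by blast
    note central = kernel_perm1_central[folded N_def] and N_snd = kernel_perm1_snd[folded N_def]
    \<comment> \<open>Kernel elements carry no conjugation, so the complement part of an element
      without conjugation has none either and commutes with the kernel.\<close>
    have dec: "\<exists>n x. g = n \<otimes>\<^bsub>G\<^esub> x \<and> n \<in> N \<and> x \<in> C \<and> \<not> snd (snd x)"
      if g: "g \<in> carrier G" "\<not> snd (snd g)" for g
    proof -
      obtain n x where nx: "n \<in> N" "x \<in> C" "g = n \<otimes>\<^bsub>G\<^esub> x"
        using g(1) unfolding C(3)[symmetric] set_mult_def by blast
      have "snd (snd (n \<otimes>\<^bsub>G\<^esub> x)) = (snd (snd n) \<noteq> snd (snd x))"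
        by (cases n; cases x) (simp add: Aut_star_H6_ops mult_GL_pair_star)
      then show ?thesis using nx g(2) N_snd by blast
    qed
    obtain n x where x: "lift456 = n \<otimes>\<^bsub>G\<^esub> x" "n \<in> N" "x \<in> C" "\<not> snd (snd x)"
      using dec[OF lift_in_Aut(1)] by (auto simp: lift456_def mono_pair_def)
    obtain m y where y: "lift123 = m \<otimes>\<^bsub>G\<^esub> y" "m \<in> N" "y \<in> C" "\<not> snd (snd y)"
      using dec[OF lift_in_Aut(2)] by (auto simp: lift123_def mono_pair_def)
    have z: "omega_scalar \<in> N"
      by (simp add: N_def kernel_perm1 omega_scalar_def)
    have eq: "(n \<otimes>\<^bsub>G\<^esub> x) \<otimes>\<^bsub>G\<^esub> (m \<otimes>\<^bsub>G\<^esub> y) = omega_scalar \<otimes>\<^bsub>G\<^esub> ((m \<otimes>\<^bsub>G\<^esub> y) \<otimes>\<^bsub>G\<^esub> (n \<otimes>\<^bsub>G\<^esub> x))"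
      using lift_commutator
      unfolding Aut_star_H6_ops x(1)[unfolded Aut_star_H6_ops, symmetric] y(1)[unfolded Aut_star_H6_ops, symmetric] .
    have xy: "x \<otimes>\<^bsub>G\<^esub> y = omega_scalar \<otimes>\<^bsub>G\<^esub> (y \<otimes>\<^bsub>G\<^esub> x)"
      by (rule p1.G.central_lift_commutator[OF N[OF x(2)] N[OF y(2)] N[OF z] CG[OF x(3)] CG[OF y(3)]
          central[OF x(2,4)] central[OF x(2) y(4)] central[OF y(2) x(4)] central[OF y(2,4)]
          central[OF x(2) N_snd[OF y(2)]] central[OF x(2) N_snd[OF z]] central[OF y(2) N_snd[OF z]] eq])
    have "omega_scalar = (x \<otimes>\<^bsub>G\<^esub> y) \<otimes>\<^bsub>G\<^esub> inv\<^bsub>G\<^esub> (y \<otimes>\<^bsub>G\<^esub> x)"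
      by (rule p1.G.inv_solve_right[THEN iffD2, OF N[OF z] _ _ xy])
        (intro p1.G.m_closed CG[OF x(3)] CG[OF y(3)])+
    also have "\<dots> \<in> C"
      by (intro subgroup.m_closed[OF C(1)] subgroup.m_inv_closed[OF C(1)] x(3) y(3))
    finally have "omega_scalar = \<one>\<^bsub>G\<^esub>" using z C(2) by blast
    then have "(mat \<omega> :: complex^6^6) $ 1 $ 1 = (mat 1 :: complex^6^6) $ 1 $ 1"
      by (simp add: omega_scalar_def Aut_star_H6_ops)
    then show False by (simp add: mat_def)
  qed
  then show ?thesis
    unfolding nonsplit_extension_def N_def
    using p1.normal_kernel p1.FactGroup_iso[OF perm1_surj] by blast
qed

section \<open>Irreducibility\<close>

lemma rho1_monom_mat_vector_mult:
  "rho1 (monom_mat p \<sigma>, Q, False) *v v = (\<chi> i. sq_of_complex (p $ i) * v $ \<sigma> i)"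
  unfolding rho_beta_if sq_matrix_monom_mat_beta_if monom_mat_vector_mult
  by (simp add: beta_if_def)

text \<open>Since \<open>perm1\<close> is onto, every permutation of the coordinates is realised by
  the group up to unit factors from the left.\<close>

lemma rho1_vector_mult_E:
  assumes "bij \<sigma>"
  obtains g u where "g \<in> carrier G" "\<And>i. ring_unit (u i)" "\<And>v. rho1 g *v v = (\<chi> i. u i * v $ \<sigma> i)"
proof -
  have "\<sigma> \<in> perm1 ` carrier G"
    using assms by (simp only: perm1_surj carrier_symmetric_group mem_Collect_eq)
  then obtain g where g: "g \<in> carrier G" "perm1 g = \<sigma>" by blast
  obtain p \<sigma>' q \<tau> e where g_eq: "g = (monom_mat p \<sigma>', monom_mat q \<tau>, e)" "bij \<sigma>'" "\<And>i. p $ i \<noteq> 0"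
    using Aut_star_H6_E[OF g(1)] by metis
  have "\<sigma>' = \<sigma>" using g(2) perm_monom_mat(1)[OF g_eq(2,3)] unfolding g_eq(1) by simp
  then have "rho1 g *v v = (\<chi> i. sq_of_complex (p $ i) * beta_if e * v $ \<sigma> i)" for v
    unfolding g_eq(1) rho_beta_if sq_matrix_monom_mat_beta_if monom_mat_vector_mult by simp
  then show thesis
    using that[OF g(1), of "\<lambda>i. sq_of_complex (p $ i) * beta_if e"]
      ring_unit_sq_of_complex_beta_if[OF g_eq(3)] by simp
qed

lemma sq_omega_sum: "sq_of_complex \<omega> * s + sq_of_complex (cnj \<omega>) * s = - s"
proof -
  have "sq_of_complex \<omega> + sq_of_complex (cnj \<omega>) = - 1"
    by (simp add: omega_sum split_quat_defs)
  then show ?thesis by (simp flip: distrib_right)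
qed

context
  fixes W :: "(split_quat^6) set"
  assumes W: "right_submodule W"
    and invariant: "\<And>g v. g \<in> carrier G \<Longrightarrow> v \<in> W \<Longrightarrow> rho1 g *v v \<in> W"
begin

lemma W_add: "v \<in> W \<Longrightarrow> w \<in> W \<Longrightarrow> v + w \<in> W"
  and W_right_mult: "v \<in> W \<Longrightarrow> (\<chi> i. v $ i * b) \<in> W"
  using W by (auto simp: right_submodule_def)

lemma unit_vec_right_mult: "unit_vec j x \<in> W \<Longrightarrow> unit_vec j (x * b) \<in> W"
  using W_right_mult[of "unit_vec j x" b]
  by (simp add: unit_vec_def if_distrib[of "\<lambda>x. x * b"] cong: if_cong)

lemma unit_vec_add: "unit_vec j x \<in> W \<Longrightarrow> unit_vec j y \<in> W \<Longrightarrow> unit_vec j (x + y) \<in> W"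
  using W_add[of "unit_vec j x" "unit_vec j y"]
  by (simp add: unit_vec_def vec_eq_iff plus_vec_def if_distrib cong: if_cong)

text \<open>Averaging over \<open>tau1\<close> makes the last five coordinates equal; applying \<open>lift456\<close> and averaging
  again multiplies them by \<open>(2 \<omega> + 2 cnj \<omega> + 1) / 5 = - 1 / 5\<close> and fixes the first coordinate.\<close>

lemma unit_vec_first_coordinate:
  assumes "v \<in> W"
  shows "unit_vec 1 (v $ 1) \<in> W"
proof -
  define A :: "split_quat^6 \<Rightarrow> split_quat^6" where "A w = vector [w $ 1, w $ 3, w $ 4, w $ 5, w $ 6, w $ 2]" for w
  define B :: "split_quat^6 \<Rightarrow> split_quat^6" where
    "B w = vector [w $ 1, sq_of_complex \<omega> * w $ 2, sq_of_complex (cnj \<omega>) * w $ 3,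
      sq_of_complex (cnj \<omega>) * w $ 5, sq_of_complex \<omega> * w $ 6, w $ 4]" for w
  \<comment> \<open>The sum over the powers of \<open>tau1\<close>, that is, five times the
    average.\<close>
  define S where "S w = w + A w + A (A w) + A (A (A w)) + A (A (A (A w)))" for w
  have "A w = rho1 tau1 *v w" for w
    unfolding tau1_mono_pair mono_pair_def mono6_def rho1_monom_mat_vector_mult
    by (simp add: vec_eq_iff forall_6 A_def sq_of_complex_hom)
  then have A: "A w \<in> W" if "w \<in> W" for w using invariant[OF tau1_in_Aut that] by simp
  have "B w = rho1 lift456 *v w" for w
    unfolding lift456_def mono_pair_def mono6_def rho1_monom_mat_vector_mult
    by (simp add: vec_eq_iff forall_6 B_def sq_of_complex_hom)
  then have B: "B w \<in> W" if "w \<in> W" for w using invariant[OF lift_in_Aut(1) that] by simp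
  have S: "S w \<in> W" if "w \<in> W" for w
    unfolding S_def using that by (intro W_add A)
  define s where "s = v $ 2 + v $ 3 + v $ 4 + v $ 5 + v $ 6"
  have S_eq: "S w = vector [5 *\<^sub>R w $ 1, t, t, t, t, t]" if "t = w $ 2 + w $ 3 + w $ 4 + w $ 5 + w $ 6" for w t
  proof -
    have "x + x + x + x + x = 5 *\<^sub>R x" for x :: split_quat
      by (cases x) (simp add: split_quat_defs complex_eq_iff)
    then show ?thesis
      using that by (simp add: vec_eq_iff forall_6 S_def A_def)
  qed
  have Sv: "S v = vector [5 *\<^sub>R v $ 1, s, s, s, s, s]"
    by (rule S_eq) (simp add: s_def)
  have "S (B (S v)) = vector [25 *\<^sub>R v $ 1, - s, - s, - s, - s, - s]"
  proof -
    have "sq_of_complex \<omega> * s + sq_of_complex (cnj \<omega>) * s + sq_of_complex (cnj \<omega>) * s + sq_of_complex \<omega> * s + s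
        = (sq_of_complex \<omega> * s + sq_of_complex (cnj \<omega>) * s) + (sq_of_complex \<omega> * s + sq_of_complex (cnj \<omega>) * s) + s"
      by (simp only: ac_simps)
    then have "- s = B (S v) $ 2 + B (S v) $ 3 + B (S v) $ 4 + B (S v) $ 5 + B (S v) $ 6"
      by (simp add: B_def Sv sq_omega_sum)
    from S_eq[OF this] show ?thesis by (simp add: B_def Sv)
  qed
  \<comment> \<open>The coordinates \<open>s\<close> and \<open>- s\<close> cancel, and the first
    one becomes 5 + 25 = 30 times \<open>v $ 1\<close>. The real factor is central and is written on
    the right to match the module structure.\<close>
  then have "S v + S (B (S v)) = (\<chi> i. unit_vec 1 (v $ 1) $ i * (30 *\<^sub>R 1))"
    by (simp add: vec_eq_iff forall_6 Sv unit_vec_def flip: scaleR_left_distrib)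
  then have "(\<chi> i. unit_vec 1 (v $ 1) $ i * (30 *\<^sub>R 1)) \<in> W"
    using W_add S B assms by metis
  from W_right_mult[OF this, of "(1 / 30) *\<^sub>R 1"] show ?thesis by simp
qed

text \<open>Split-quaternions have zero divisors, so \<open>x\<close> need not be invertible. For x
  = a + \<beta> b and complex z, the element \<omega> x z - x equals a (\<omega> z - 1) + \<beta> b
  (\<open>cnj \<omega>\<close> z - 1). Taking z = \<omega> leaves the complex part and z =
  \<open>cnj \<omega>\<close> the \<beta> part; each is invertible when nonzero.\<close>

lemma unit_vec_first_1:
  assumes "x \<noteq> 0" and x: "unit_vec 1 x \<in> W"
  shows "unit_vec 1 1 \<in> W"
proof -
  have "rho1 omega_scalar *v unit_vec 1 y = unit_vec 1 (sq_of_complex \<omega> * y)" for y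
    unfolding omega_scalar_def monom_mat_id[symmetric] rho1_monom_mat_vector_mult
    by (simp add: vec_eq_iff unit_vec_def)
  then have left: "unit_vec 1 (sq_of_complex \<omega> * y) \<in> W" if "unit_vec 1 y \<in> W" for y
    using invariant[OF omega_scalar_in_Aut that] by simp
  have mem: "unit_vec 1 (sq_of_complex \<omega> * x * sq_of_complex z + x * (- 1)) \<in> W" for z
    by (intro unit_vec_add unit_vec_right_mult left x)
  obtain a b where ab: "x = SQ a b" by (cases x)
  show ?thesis
  proof (cases "a = 0")
    case False
    have "(sq_of_complex \<omega> * x * sq_of_complex \<omega> + x * (- 1)) * SQ (1 / (a * (cnj \<omega> - 1))) 0 = 1"
    proof -
      have "\<omega> * a * \<omega> - a = a * (cnj \<omega> - 1)" "cnj \<omega> * b * \<omega> - b = 0"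
        by (simp_all add: algebra_simps mult.left_commute[of _ b] flip: mult.assoc[of \<omega> \<omega>])
      then show ?thesis using False by (simp add: ab split_quat_defs)
    qed
    then show ?thesis using unit_vec_right_mult[OF mem] by metis
  next
    case True
    then have "b \<noteq> 0" using assms(1) ab by (simp add: split_quat_defs)
    have "(sq_of_complex \<omega> * x * sq_of_complex (cnj \<omega>) + x * (- 1)) * SQ 0 (1 / cnj (b * (\<omega> - 1))) = 1"
    proof -
      have "cnj \<omega> * b * cnj \<omega> - b = b * (\<omega> - 1)"
        by (metis (no_types, opaque_lifting) mult.assoc mult.commute mult.right_neutral omega_mult(4) right_diff_distrib)
      then have "\<omega> * cnj b * \<omega> - cnj b = cnj (b * (\<omega> - 1))"
        by (metis complex_cnj_cnj complex_cnj_diff complex_cnj_mult)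
      then show ?thesis using True \<open>b \<noteq> 0\<close> by (simp add: ab split_quat_defs)
    qed
    then show ?thesis using unit_vec_right_mult[OF mem] by metis
  qed
qed

text \<open>A nonzero coordinate is moved to the first place, isolated and normalised to 1. The
  resulting basis vector is then moved to every position and scaled from the right.\<close>

lemma submodule_trivial: "W = {0} \<or> W = UNIV"
proof (cases "W \<subseteq> {0}")
  case True
  then show ?thesis using W by (auto simp: right_submodule_def)
next
  case False
  then obtain w where "w \<in> W" "w \<noteq> 0" by blast
  then obtain j where w: "w \<in> W" "w $ j \<noteq> 0"
    by (auto simp: vec_eq_iff)
  obtain g u where g: "g \<in> carrier G" "\<And>i. ring_unit (u i)"
    "\<And>v. rho1 g *v v = (\<chi> i. u i * v $ Transposition.transpose 1 j i)"
    by (rule rho1_vector_mult_E[OF bij_transpose[of 1 j]], rule that)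
  obtain u' where "u' * u 1 = 1" using g(2)[of 1] unfolding ring_unit_def by blast
  then have "u 1 * w $ j \<noteq> 0" using w(2) by (metis mult.assoc mult_1 mult_zero_right)
  moreover have "unit_vec 1 (u 1 * w $ j) \<in> W"
    using unit_vec_first_coordinate[OF invariant[OF g(1) w(1)]] by (simp add: g(3))
  ultimately have first: "unit_vec 1 1 \<in> W" by (rule unit_vec_first_1)
  have units: "unit_vec k y \<in> W" for k y
  proof -
    obtain g u where g: "g \<in> carrier G" "\<And>i. ring_unit (u i)"
      "\<And>v. rho1 g *v v = (\<chi> i. u i * v $ Transposition.transpose 1 k i)"
      by (rule rho1_vector_mult_E[OF bij_transpose[of 1 k]], rule that)
    have "rho1 g *v unit_vec 1 1 = unit_vec k (u k)"
      by (auto simp: g(3) vec_eq_iff unit_vec_def Transposition.transpose_def)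
    then have "unit_vec k (u k) \<in> W" using invariant[OF g(1) first] by simp
    moreover obtain u' where "u k * u' = 1" using g(2)[of k] unfolding ring_unit_def by blast
    \<comment> \<open>The left unit \<open>u k\<close> is the whole entry, so right multiplication
      by its inverse and then by \<open>y\<close> produces \<open>y\<close>.\<close>
    ultimately show ?thesis
      using unit_vec_right_mult[of k "u k" "u' * y"] by (simp flip: mult.assoc)
  qed
  have "v \<in> W" for v
  proof -
    have "v = unit_vec 1 (v $ 1) + unit_vec 2 (v $ 2) + unit_vec 3 (v $ 3) + unit_vec 4 (v $ 4)
        + unit_vec 5 (v $ 5) + unit_vec 6 (v $ 6)"
      by (simp add: vec_eq_iff forall_6 unit_vec_def)
    also have "\<dots> \<in> W" by (intro W_add units)
    finally show ?thesis .
  qed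
  then show ?thesis by blast
qed

end

lemma rho1_irreducible: "irreducible_representation G rho1"
proof -
  have "W = {0} \<or> W = UNIV"
    if "right_submodule W \<and> (\<forall>g\<in>carrier G. \<forall>v\<in>W. rho1 g *v v \<in> W)" for W
    using that by (intro submodule_trivial) blast+
  then show ?thesis
    using rho_monomial(1) unfolding irreducible_representation_def monomial_representation_def
    by blast
qed

text \<open>The representation \<open>rho1\<close> is pulled back along the isomorphism. As that map
  is onto, invariance under the pullback is invariance under \<open>rho1\<close>.\<close>

lemma irreducible_representation_iso:
  assumes "(K :: 'k monoid) \<cong> G"
  shows "\<exists>\<rho> :: 'k \<Rightarrow> split_quat^6^6. monomial_representation K \<rho> \<and> irreducible_representation K \<rho>"
proof -
  obtain f where f: "f \<in> hom K G" "f ` carrier K = carrier G"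
    using assms unfolding is_iso_def iso_def bij_betw_def by blast
  then have closed: "f k \<in> carrier G" if "k \<in> carrier K" for k
    using that by blast
  have "rho1 \<in> hom G GL"
    using rho_monomial(1) unfolding monomial_representation_def matrix_representation_def by blast
  then have hom: "matrix_representation K (rho1 \<circ> f)"
    unfolding matrix_representation_def using f(1) hom_compose by blast
  moreover have "monomial_matrix ((rho1 \<circ> f) k)" if "k \<in> carrier K" for k
    using rho_monomial(1) closed[OF that] unfolding monomial_representation_def by simp
  moreover have "W = {0} \<or> W = UNIV"
    if W: "right_submodule W" "\<forall>k\<in>carrier K. \<forall>v\<in>W. (rho1 \<circ> f) k *v v \<in> W" for W
  proof -
    have "\<forall>g\<in>carrier G. \<forall>v\<in>W. rho1 g *v v \<in> W"
      unfolding f(2)[symmetric] ball_simps using W(2) unfolding o_apply .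
    then show ?thesis
      using W(1) rho1_irreducible unfolding irreducible_representation_def by blast
  qed
  ultimately show ?thesis
    unfolding monomial_representation_def irreducible_representation_def by blast
qed

end

theorem theorem4:
  fixes \<omega> :: complex
  assumes "primitive_root_of_unity 3 \<omega>"
  defines "G \<equiv> Aut_star_H6 \<omega>"
    and "S6 \<equiv> (symmetric_group :: (6 \<Rightarrow> 6) monoid)"
    and "H \<equiv> sq_matrix (H6 \<omega>)"
  shows
    "(\<exists>N. card N = 3 \<and> nonsplit_extension G N S6)
     \<and> (\<forall>K :: 'k monoid. group K \<and> K \<cong> G \<longrightarrow>
          (\<exists>\<rho> :: 'k \<Rightarrow> split_quat^6^6.
             monomial_representation K \<rho> \<and> irreducible_representation K \<rho>))
     \<and> monomial_representation G rho1
     \<and> monomial_representation G rho2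
     \<and> invertible H
     \<and> (\<forall>g\<in>carrier G. rho1 g = H ** rho2 g ** matrix_inv H)
     \<and> (\<exists>\<phi>. \<phi> \<in> iso S6 S6 \<and> \<not> inner_automorphism S6 \<phi> \<and>
          {(underlying_perm (rho1 g), underlying_perm (rho2 g)) | g. g \<in> carrier G}
            = {(\<sigma>, \<phi> \<sigma>) | \<sigma>. \<sigma> \<in> carrier S6})"
proof -
  interpret primitive_cube_root \<omega> by standard (rule assms(1))
  have "card (kernel G S6 perm1) = 3" "nonsplit_extension G (kernel G S6 perm1) S6"
    unfolding G_def S6_def by (rule card_kernel_perm1, rule nonsplit_extension_kernel_perm1)
  moreover have "\<forall>K :: 'k monoid. group K \<and> K \<cong> G \<longrightarrow>
      (\<exists>\<rho> :: 'k \<Rightarrow> split_quat^6^6. monomial_representation K \<rho> \<and> irreducible_representation K \<rho>)"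
    unfolding G_def using irreducible_representation_iso by blast
  moreover have "\<forall>g\<in>carrier G. rho1 g = H ** rho2 g ** matrix_inv H"
    unfolding G_def H_def using rho_intertwine by blast
  moreover have "monomial_representation G rho1" "monomial_representation G rho2" "invertible H"
    unfolding G_def H_def by (rule rho_monomial invertible_sq_H6)+
  moreover have "outer \<in> iso S6 S6" "\<not> inner_automorphism S6 outer"
    "{(underlying_perm (rho1 g), underlying_perm (rho2 g)) | g. g \<in> carrier G}
      = {(\<sigma>, outer \<sigma>) | \<sigma>. \<sigma> \<in> carrier S6}"
    unfolding G_def S6_def
    by (rule outer_iso, rule outer_not_inner, rule outer_graph[unfolded perm1_def perm2_def])
  ultimately show ?thesis by blast
qed

end
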